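(* Let $\boldsymbol n=(n_1,n_2)\in\mathbb Z_{\ge0}^2$, $N=n_1+n_2$, and let $P_{\boldsymbol n}$ be a monic polynomial of degree $N$ satisfying $$\int_{\Delta_i}x^jP_{\boldsymbol n}(x)w_i(x)\,dx\begin{cases}=0,&j\le n_i-1,\\ \ne0,&j=n_i,\end{cases}\qquad i=1,2,$$ with electrostatic partners $S_{\boldsymbol n,1},S_{\boldsymbol n,2}$ and with the polynomial $R_{\boldsymbol n}=(A_1A_2v_1v_2)\,\mathfrak{Wrons}[P_{\boldsymbol n},q_{\boldsymbol n,1},q_{\boldsymbol n,2}]$. There exist polynomials $D_1$ and $D_2$ (in general, dependent on $\boldsymbol n$) such that $S_{\boldsymbol n,1}$ is a solution of the linear differential equation $$A_1A_2P_{\boldsymbol n}R_{\boldsymbol n}\,y''+\left((2A_1A_2'+A_1B_2-A_2B_1)P_{\boldsymbol n}R_{\boldsymbol n}-A_1A_2(P_{\boldsymbol n}R_{\boldsymbol n}'+P_{\boldsymbol n}'R_{\boldsymbol n})\right)y'+D_1y=0,$$ and $S_{\boldsymbol n,2}$ satisfies $$A_1A_2P_{\boldsymbol n}R_{\boldsymbol n}\,y''+\left((2A_1'A_2-A_1B_2+A_2B_1)P_{\boldsymbol n}R_{\boldsymbol n}-A_1A_2(P_{\boldsymbol n}R_{\boldsymbol n}'+P_{\boldsymbol n}'R_{\boldsymbol n})\right)y'+D_2y=0.$$ If $A_1=A_2=:A$ and $B_1=B_2$, then the two differential equations coincide, i.e. $S_{\boldsymbol n,1}$ and $S_{\boldsymbol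 n,2}$ are solutions of the same differential equation $$P_{\boldsymbol n}R_{\boldsymbol n}^*\,y''-\left(P_{\boldsymbol n}'R_{\boldsymbol n}^*+P_{\boldsymbol n}(R_{\boldsymbol n}^* )'\right)y'+D^*y=0,$$ where $R_{\boldsymbol n}^*=R_{\boldsymbol n}/A^2$ (a polynomial), and $D^*$ is a certain polynomial, dependent on $\boldsymbol n$.
   Context: Two semiclassical weights. For $i=1,2$: $A_i$ (monic) and $B_i$ are real polynomials; $\Delta_i\subset\mathbb R$ is a finite union of non-overlapping intervals joining real zeros of $A_i$ and possibly $\infty$ (with no zero of $A_i$ in the interior of these intervals); $w_i(z)=\exp\left(\int^z\frac{B_i(t)}{A_i(t)}dt\right)$ is a (multivalued) analytic function, and on each interval of $\Delta_i$ the weight, also denoted $w_i$, is positive and coincides up to a non-zero multiplicative constant with a boundary value $(w_i)_+$ of this function. Thus $w_i'/w_i=B_i/A_i$. Put $v_i=A_iw_i$. All moments are finite: $\int_{\Delta_i}|x|^m|w_i(x)|dx<+\infty$, $m=0,1,2,\dots$; as a consequence $z^mv_i(z)=0$ (in the limit sense) at the endpoints of every subinterval of $\Delta_i$. $\sigma_i=\max\{\deg(A_i)-2,\deg(B_i)-1\}$ is assumed $\ge0$. When $A_1=A_2=A$ and $B_1=B_2=B$, the analytic functions $w_1,w_2$ are normalized so that $w_1=w_2=w=\exp\left(\int^z B/A\right)$ for every selection of the branch. Cauchy transform: $\mathfrak C_{w_i}[f](z)=\int_{\Delta_i}\frac{f(t)w_i(t)}{t-z}dt$. Functions of the second kind: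 $q_{\boldsymbol n,i}=\mathfrak C_{w_i}[P_{\boldsymbol n}]/w_i$. $\mathfrak{Wrons}[f_1,\dots,f_k]=\det\left(f_j^{(i-1)}\right)_{i,j=1}^k$ is the Wronskian determinant. Electrostatic partners (which are polynomials): $$S_{\boldsymbol n,i}=\mathfrak D_{w_i}[P_{\boldsymbol n}]:=\det\begin{pmatrix}P_{\boldsymbol n}&\mathfrak C_{w_i}[P_{\boldsymbol n}]\\ A_iP_{\boldsymbol n}'&A_i(\mathfrak C_{w_i}[P_{\boldsymbol n}])'-B_i\,\mathfrak C_{w_i}[P_{\boldsymbol n}]\end{pmatrix}=v_i\,\mathfrak{Wrons}[P_{\boldsymbol n},q_{\boldsymbol n,i}].$$ The function $R_{\boldsymbol n}$ is a polynomial, divisible by $A^2$ when $A_1=A_2=A$ and $B_1=B_2$. Standing assumption: $\mathfrak{Wrons}[P_{\boldsymbol n},q_{\boldsymbol n,1},q_{\boldsymbol n,2}]\not\equiv0$. *)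

theory Defs
  imports "HOL-Analysis.Analysis" "HOL-Computational_Algebra.Polynomial"
begin

abbreviation cpoly :: "real poly \<Rightarrow> complex poly" where
  "cpoly p \<equiv> map_poly complex_of_real p"

text \<open>
  A finite system of real intervals is encoded by the set \<open>J\<close> of its pairs of endpoints, which
  may be infinite; the intervals are closed, and \<open>einterval a b\<close> is the interior.
\<close>

definition support_set :: "(ereal \<times> ereal) set \<Rightarrow> real set" where
  "support_set J = (\<Union>(a, b)\<in>J. {x. a \<le> ereal x \<and> ereal x \<le> b})"

definition admissible_intervals :: "real poly \<Rightarrow> (ereal \<times> ereal) set \<Rightarrow> bool" where
  "admissible_intervals A J \<longleftrightarrow>
     finite J \<and>
     (\<forall>(a, b)\<in>J. a < b \<and>
        (a = -\<infinity> \<or> (\<exists>x. a = ereal x \<and> poly A x = 0)) \<and>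
        (b = \<infinity> \<or> (\<exists>x. b = ereal x \<and> poly A x = 0)) \<and>
        (\<forall>x\<in>einterval a b. poly A x \<noteq> 0)) \<and>
     disjoint_family_on (\<lambda>(a, b). einterval a b) J"

text \<open>
  \<open>W\<close> is a branch on the open set \<open>U\<close> of the multivalued function \<open>exp (\<integral>\<^sup>z B/A)\<close>:
  \<open>F\<close> is a primitive of \<open>B/A\<close> on \<open>U\<close>, with arbitrary constants of integration.
\<close>

definition exp_branch ::
  "real poly \<Rightarrow> real poly \<Rightarrow> complex set \<Rightarrow> (complex \<Rightarrow> complex) \<Rightarrow> bool" where
  "exp_branch A B U W \<longleftrightarrow>
     open U \<and>
     (\<exists>F. \<forall>z\<in>U. poly (cpoly A) z \<noteq> 0 \<and>
        (F has_field_derivative poly (cpoly B) z / poly (cpoly A) z) (at z) \<and>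
        W z = exp (F z))"

text \<open>
  The real weight \<open>w\<close> is only relevant on the open intervals. On each of them it is, up to a
  constant \<open>c\<close> depending on the interval, the boundary value from the upper half-plane of a
  branch defined on some one-sided neighbourhood \<open>U\<close> of the interval.
\<close>

definition weight_on ::
  "real poly \<Rightarrow> real poly \<Rightarrow> (ereal \<times> ereal) set \<Rightarrow> (real \<Rightarrow> real) \<Rightarrow> bool" where
  "weight_on A B J w \<longleftrightarrow>
     (\<forall>(a, b)\<in>J. \<exists>U W c. exp_branch A B U W \<and> c \<noteq> 0 \<and>
        (\<forall>x\<in>einterval a b. w x > 0 \<and>
           (\<forall>\<^sub>F z in at (complex_of_real x) within {z. Im z > 0}. z \<in> U) \<and>
           ((\<lambda>z. c * W z) \<longlongrightarrow> complex_of_real (w x))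
             (at (complex_of_real x) within {z. Im z > 0})))"

definition sigma :: "real poly \<Rightarrow> real poly \<Rightarrow> int" where
  "sigma A B = max (int (degree A) - 2) (int (degree B) - 1)"

definition semiclassical_weight ::
  "real poly \<Rightarrow> real poly \<Rightarrow> (ereal \<times> ereal) set \<Rightarrow> (real \<Rightarrow> real) \<Rightarrow> bool" where
  "semiclassical_weight A B J w \<longleftrightarrow>
     lead_coeff A = 1 \<and>
     admissible_intervals A J \<and>
     weight_on A B J w \<and>
     (\<forall>m::nat. set_integrable lborel (support_set J) (\<lambda>x. \<bar>x\<bar> ^ m * \<bar>w x\<bar>)) \<and>
     sigma A B \<ge> 0"

definition moment ::
  "(ereal \<times> ereal) set \<Rightarrow> (real \<Rightarrow> real) \<Rightarrow> complex poly \<Rightarrow> nat \<Rightarrow> complex" where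
  "moment J w P j =
     (LINT x:support_set J|lborel.
        complex_of_real x ^ j * poly P (complex_of_real x) * complex_of_real (w x))"

text \<open>Meaningful for \<open>z\<close> outside the support only.\<close>

definition cauchy_transform ::
  "(ereal \<times> ereal) set \<Rightarrow> (real \<Rightarrow> real) \<Rightarrow> (complex \<Rightarrow> complex) \<Rightarrow> complex \<Rightarrow> complex" where
  "cauchy_transform J w f z =
     (LINT t:support_set J|lborel.
        f (complex_of_real t) * complex_of_real (w t) / (complex_of_real t - z))"

definition electrostatic_partner ::
  "real poly \<Rightarrow> real poly \<Rightarrow> (ereal \<times> ereal) set \<Rightarrow> (real \<Rightarrow> real) \<Rightarrow>
     (complex \<Rightarrow> complex) \<Rightarrow> complex \<Rightarrow> complex" where
  "electrostatic_partner A B J w f z =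
     (let C = cauchy_transform J w f; a = poly (cpoly A) z; b = poly (cpoly B) z in
      det (vector [vector [f z, C z],
                   vector [a * deriv f z, a * deriv C z - b * C z]] :: complex^2^2))"

text \<open>The argument \<open>W\<close> is the chosen branch of the analytic weight.\<close>

definition second_kind ::
  "(ereal \<times> ereal) set \<Rightarrow> (real \<Rightarrow> real) \<Rightarrow> (complex \<Rightarrow> complex) \<Rightarrow>
     complex poly \<Rightarrow> complex \<Rightarrow> complex" where
  "second_kind J w W P z = cauchy_transform J w (poly P) z / W z"

definition wronskian3 ::
  "(complex \<Rightarrow> complex) \<Rightarrow> (complex \<Rightarrow> complex) \<Rightarrow> (complex \<Rightarrow> complex) \<Rightarrow> complex \<Rightarrow> complex" where
  "wronskian3 f g h z =
     det (vector [vector [f z, g z, h z],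
                  vector [deriv f z, deriv g z, deriv h z],
                  vector [deriv (deriv f) z, deriv (deriv g) z, deriv (deriv h) z]] :: complex^3^3)"

text \<open>
  A common domain for branches of both weights on which both Cauchy transforms are analytic.
  The product \<open>W1 W2 Wrons[P, q1, q2]\<close> does not change when \<open>W1\<close> or \<open>W2\<close> is multiplied by a
  (locally) constant factor, so the choice of branches and their normalization are immaterial.
\<close>

definition branch_pair ::
  "real poly \<Rightarrow> real poly \<Rightarrow> (ereal \<times> ereal) set \<Rightarrow> real poly \<Rightarrow> real poly \<Rightarrow> (ereal \<times> ereal) set \<Rightarrow>
     complex set \<Rightarrow> (complex \<Rightarrow> complex) \<Rightarrow> (complex \<Rightarrow> complex) \<Rightarrow> bool" where
  "branch_pair A1 B1 J1 A2 B2 J2 U W1 W2 \<longleftrightarrow>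
     exp_branch A1 B1 U W1 \<and> exp_branch A2 B2 U W2 \<and>
     U \<inter> complex_of_real ` (support_set J1 \<union> support_set J2) = {}"

definition solves_ode2 ::
  "complex poly \<Rightarrow> complex poly \<Rightarrow> complex poly \<Rightarrow> complex poly \<Rightarrow> bool" where
  "solves_ode2 p2 p1 p0 y \<longleftrightarrow> p2 * pderiv (pderiv y) + p1 * pderiv y + p0 * y = 0"

end

theory Submission
  imports Defs "HOL-Complex_Analysis.Complex_Analysis"
begin

text \<open>
  Write \<open>h(z) = \<integral> w(t) / (t - z) dt\<close> for the Stieltjes function of one of the weights. Two facts
  about \<open>h\<close> turn the theorem into an identity between polynomials.

  First, the Cauchy transform of \<open>P\<close> is \<open>c + P h\<close>, where
  \<open>c(z) = \<integral> (P(t) - P(z)) / (t - z) w(t) dt\<close> is a polynomial, as the integrand is a polynomial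
  in \<open>z\<close> and \<open>t\<close> (\<open>cauchy_transform_poly\<close>).

  Secondly, \<open>A h' = B h + k\<close> for a polynomial \<open>k\<close> (\<open>stieltjes_first_order_equation\<close>). Expanding
  \<open>A(z)\<close> and \<open>B(z)\<close> around \<open>t\<close> in \<open>A h' - B h\<close> leaves a polynomial minus the integral of the
  derivative of \<open>A(t) w(t) / (t - z)\<close>, because \<open>(A w)' = (A' + B) w\<close>. That integral vanishes
  (\<open>integral_Pearson_derivative_eq_0\<close>) because \<open>A w / (t - z)\<close> gets arbitrarily small near every
  endpoint: otherwise \<open>w\<close> would be at least a multiple of \<open>1 / |t - \<beta>|\<close> near a zero \<open>\<beta>\<close> of \<open>A\<close>, or
  \<open>A w\<close> would stay away from \<open>0\<close> near infinity, against the integrability of all moments.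

  Now put \<open>F = A c' - B c + P k\<close>. In the electrostatic partner the terms with \<open>h\<close> cancel
  and what is left is the polynomial \<open>S = P F - A P' c\<close>. In the same way
  \<open>A\<^sup>2 W (q, q', q'')\<close> is a polynomial vector plus \<open>A\<^sup>2 h (P, P', P'')\<close>
  (\<open>second_kind_jet\<close>), and adding a multiple of the column \<open>(P, P', P'')\<close> does not change the
  Wronskian; so \<open>R\<close> is a polynomial determinant in \<open>P\<close>, \<open>c\<^sub>1\<close>, \<open>c\<^sub>2\<close>, \<open>k\<^sub>1\<close> and \<open>k\<^sub>2\<close>. It satisfies
  \<open>P R = A\<^sub>1 A\<^sub>2 (S\<^sub>1 S\<^sub>2' - S\<^sub>1' S\<^sub>2) + (A\<^sub>2 (A\<^sub>1' + B\<^sub>1) - A\<^sub>1 (A\<^sub>2' + B\<^sub>2)) S\<^sub>1 S\<^sub>2\<close>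
  (\<open>wronskian_poly_factor\<close>), which is \<open>(q/P)' = S / (v P\<^sup>2)\<close> for both weights together with
  \<open>Wrons[P, q\<^sub>1, q\<^sub>2] = P\<^sup>3 Wrons[(q\<^sub>1/P)', (q\<^sub>2/P)']\<close>, cleared of denominators.

  When this relation and its derivative are inserted into the terms with \<open>S\<^sub>1''\<close> and \<open>S\<^sub>1'\<close> of the
  differential equation, all that is not a multiple of \<open>S\<^sub>1\<close> cancels, and the cofactor of \<open>S\<^sub>1\<close> is, up
  to sign, the polynomial \<open>D\<^sub>1\<close> (\<open>partner_ode\<close>). Exchanging the two weights replaces \<open>R\<close> by \<open>- R\<close>, and
  the first two coefficients are linear in \<open>R\<close>, so the case of \<open>S\<^sub>2\<close> follows.

  If \<open>A\<^sub>1 = A\<^sub>2\<close> and \<open>B\<^sub>1 = B\<^sub>2\<close>, the second term of the relation is absent and \<open>S\<^sub>1 S\<^sub>2' - S\<^sub>1' S\<^sub>2\<close> is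
  itself divisible by \<open>P\<close> (\<open>equal_weights_factor\<close>), so that \<open>A\<^sup>2\<close> splits off from \<open>R\<close>.
\<close>

section \<open>Real polynomials as complex polynomials\<close>

lemma cpoly_add: "cpoly (p + q) = cpoly p + cpoly q"
  by (rule poly_eqI) (simp add: coeff_map_poly)

lemma cpoly_diff: "cpoly (p - q) = cpoly p - cpoly q"
  by (rule poly_eqI) (simp add: coeff_map_poly)

lemma cpoly_mult: "cpoly (p * q) = cpoly p * cpoly q"
  by (rule poly_eqI) (simp add: coeff_map_poly coeff_mult)

lemma cpoly_two: "cpoly 2 = 2"
  by (simp add: numeral_poly map_poly_pCons)

lemma cpoly_pderiv: "cpoly (pderiv p) = pderiv (cpoly p)"
  by (rule poly_eqI) (simp add: coeff_map_poly coeff_pderiv)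

lemma poly_cpoly_of_real: "poly (cpoly p) (complex_of_real x) = complex_of_real (poly p x)"
  by (induction p) (simp_all add: map_poly_pCons)

section \<open>Differential algebra of the electrostatic partners\<close>

text \<open>
  Here and below the Cauchy transform of \<open>P\<close> is \<open>c + P h\<close> with \<open>A h' = B h + k\<close>. The cofactor is
  what remains of \<open>A (c + P h)' - B (c + P h)\<close> after \<open>A P' h\<close> has been removed.
\<close>

definition partner_cofactor ::
  "complex poly \<Rightarrow> complex poly \<Rightarrow> complex poly \<Rightarrow> complex poly \<Rightarrow> complex poly \<Rightarrow> complex poly" where
  "partner_cofactor A B P c k = A * pderiv c - B * c + P * k"

definition partner_poly ::
  "complex poly \<Rightarrow> complex poly \<Rightarrow> complex poly \<Rightarrow> complex poly \<Rightarrow> complex poly \<Rightarrow> complex poly" where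
  "partner_poly A B P c k = P * partner_cofactor A B P c k - A * pderiv P * c"

text \<open>
  The part without \<open>h\<close> of \<open>A\<^sup>2 W q''\<close>, where \<open>q = (c + P h) / W\<close>; see \<open>second_kind_jet\<close>.
\<close>

definition second_jet ::
  "complex poly \<Rightarrow> complex poly \<Rightarrow> complex poly \<Rightarrow> complex poly \<Rightarrow> complex poly \<Rightarrow> complex poly" where
  "second_jet A B P c k =
     (let F = partner_cofactor A B P c k
      in A * pderiv F - (pderiv A + B) * F + A * pderiv P * k)"

text \<open>
  A \<open>3 \<times> 3\<close> determinant over an arbitrary commutative ring, so that it makes sense for polynomials
  and commutes with evaluation.
\<close>

definition det3 :: "'a::comm_ring_1 \<Rightarrow> 'a \<Rightarrow> 'a \<Rightarrow> 'a \<Rightarrow> 'a \<Rightarrow> 'a \<Rightarrow> 'a \<Rightarrow> 'a \<Rightarrow> 'a \<Rightarrow> 'a" where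
  "det3 p0 p1 p2 x0 x1 x2 y0 y1 y2 =
     p0 * (x1 * y2 - x2 * y1) - p1 * (x0 * y2 - x2 * y0) + p2 * (x0 * y1 - x1 * y0)"

lemma det3_add_multiple:
  "det3 p0 p1 p2 (x0 + r * p0) (x1 + r * p1) (x2 + r * p2) (y0 + s * p0) (y1 + s * p1) (y2 + s * p2)
   = det3 p0 p1 p2 x0 x1 x2 y0 y1 y2"
  unfolding det3_def by (simp add: algebra_simps)

lemma det3_scale:
  "det3 p0 p1 p2 (r * x0) (r * x1) (r * x2) (s * y0) (s * y1) (s * y2) =
   r * s * det3 p0 p1 p2 x0 x1 x2 y0 y1 y2"
  unfolding det3_def by (simp add: algebra_simps)

definition wronskian_poly ::
  "complex poly \<Rightarrow> complex poly \<Rightarrow> complex poly \<Rightarrow> complex poly \<Rightarrow> complex poly \<Rightarrow>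
     complex poly \<Rightarrow> complex poly \<Rightarrow> complex poly \<Rightarrow> complex poly \<Rightarrow> complex poly" where
  "wronskian_poly A1 B1 A2 B2 P c1 k1 c2 k2 =
     det3 P (pderiv P) (pderiv (pderiv P))
       (A1\<^sup>2 * c1) (A1 * partner_cofactor A1 B1 P c1 k1) (second_jet A1 B1 P c1 k1)
       (A2\<^sup>2 * c2) (A2 * partner_cofactor A2 B2 P c2 k2) (second_jet A2 B2 P c2 k2)"

text \<open>
  Eliminating the column \<open>(P, P', P'')\<close> turns \<open>P\<close> times the determinant into a \<open>2 \<times> 2\<close>
  determinant. The column \<open>(X\<^sub>0, X\<^sub>1, X\<^sub>2)\<close> of a weight enters it through \<open>P X\<^sub>1 - P' X\<^sub>0 = A S\<close> and
  \<open>P X\<^sub>2 - P'' X\<^sub>0 = A S' - (A' + B) S\<close>.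
\<close>

lemma wronskian_poly_factor:
  fixes A1 B1 A2 B2 P c1 k1 c2 k2 :: "complex poly"
  defines "S1 \<equiv> partner_poly A1 B1 P c1 k1" and "S2 \<equiv> partner_poly A2 B2 P c2 k2"
  shows "P * wronskian_poly A1 B1 A2 B2 P c1 k1 c2 k2 =
    A1 * A2 * (S1 * pderiv S2 - pderiv S1 * S2) +
    (A2 * (pderiv A1 + B1) - A1 * (pderiv A2 + B2)) * (S1 * S2)"
proof -
  define F1 F2 where "F1 = partner_cofactor A1 B1 P c1 k1" and "F2 = partner_cofactor A2 B2 P c2 k2"
  have e1: "A1 * pderiv c1 = F1 + B1 * c1 - P * k1" and e2: "A2 * pderiv c2 = F2 + B2 * c2 - P * k2"
    by (simp_all add: F1_def F2_def partner_cofactor_def)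
  have d: "pderiv S1 = pderiv P * F1 + P * pderiv F1 - pderiv A1 * pderiv P * c1
              - A1 * pderiv (pderiv P) * c1 - pderiv P * (A1 * pderiv c1)"
          "pderiv S2 = pderiv P * F2 + P * pderiv F2 - pderiv A2 * pderiv P * c2
              - A2 * pderiv (pderiv P) * c2 - pderiv P * (A2 * pderiv c2)"
    by (simp_all add: S1_def S2_def partner_poly_def F1_def F2_def pderiv_mult pderiv_diff algebra_simps)
  show ?thesis
    unfolding d e1 e2 unfolding wronskian_poly_def second_jet_def Let_def det3_def S1_def S2_def partner_poly_def
      F1_def[symmetric] F2_def[symmetric]
    by algebra
qed

text \<open>
  Put \<open>X = a S\<^sub>2' + g S\<^sub>2\<close>, so that \<open>P R = S\<^sub>1 X - a S\<^sub>1' S\<^sub>2\<close>. Modulo \<open>S\<^sub>1\<close> the first two terms of the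
  equation are congruent to \<open>- a\<^sup>2 S\<^sub>1' S\<^sub>1'' S\<^sub>2 - h a S\<^sub>1'\<^sup>2 S\<^sub>2\<close> and
  \<open>- a S\<^sub>1'\<^sup>2 X + a S\<^sub>1' (a S\<^sub>1' S\<^sub>2)'\<close>. Their sum is
  \<open>a S\<^sub>1'\<^sup>2 S\<^sub>2 (a' - h - g) = 0\<close>, and what has been dropped is a multiple of \<open>S\<^sub>1\<close>, which the zeroth
  order coefficient compensates.
\<close>

lemma partner_ode:
  fixes a g h P R S1 S2 :: "complex poly"
  assumes PR: "P * R = a * (S1 * pderiv S2 - pderiv S1 * S2) + g * (S1 * S2)"
    and h: "h + g = pderiv a"
  shows "solves_ode2 (a * P * R) (h * P * R - a * (P * pderiv R + pderiv P * R))
     (a * pderiv (a * pderiv S2 + g * S2) * pderiv S1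
        - (a * pderiv S2 + g * S2) * (a * pderiv (pderiv S1) + h * pderiv S1)) S1"
proof -
  have eq: "P * pderiv R + pderiv P * R = pderiv (P * R)"
    by (simp add: pderiv_mult algebra_simps)
  show ?thesis
    unfolding solves_ode2_def mult.assoc[of _ P R] eq PR
    unfolding pderiv_mult pderiv_add pderiv_diff h[symmetric]
    by algebra
qed

text \<open>
  For common \<open>A\<close> and \<open>B\<close> both \<open>S\<^sub>i\<close> and \<open>S\<^sub>i'\<close> are, modulo \<open>P\<close>, the polynomial \<open>c\<^sub>i\<close> times a factor
  that does not depend on \<open>i\<close>. Hence \<open>S\<^sub>1 S\<^sub>2' - S\<^sub>1' S\<^sub>2\<close> vanishes modulo \<open>P\<close>.
\<close>

lemma equal_weights_factor:
  fixes A B P c1 k1 c2 k2 :: "complex poly"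
  assumes "P \<noteq> 0"
  defines "S1 \<equiv> partner_poly A B P c1 k1" and "S2 \<equiv> partner_poly A B P c2 k2"
  obtains R where "wronskian_poly A B A B P c1 k1 c2 k2 = A\<^sup>2 * R"
    and "P * R = S1 * pderiv S2 - pderiv S1 * S2"
proof -
  define F1 F2 where "F1 = partner_cofactor A B P c1 k1" and "F2 = partner_cofactor A B P c2 k2"
  \<comment> \<open>Modulo \<open>P\<close>: \<open>S\<^sub>i = - A P' c\<^sub>i\<close> and \<open>S\<^sub>i' = - L c\<^sub>i\<close>; the \<open>Z\<^sub>i\<close> are the quotients of \<open>S\<^sub>i' + L c\<^sub>i\<close> by \<open>P\<close>.\<close>
  define L where "L = B * pderiv P + pderiv A * pderiv P + A * pderiv (pderiv P)"
  define Z1 Z2 where "Z1 = pderiv F1 + pderiv P * k1" and "Z2 = pderiv F2 + pderiv P * k2"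
  define R where "R = F1 * (P * Z2 - L * c2) - F2 * (P * Z1 - L * c1) + A * pderiv P * (c2 * Z1 - c1 * Z2)"
  have e1: "A * pderiv c1 = F1 + B * c1 - P * k1" and e2: "A * pderiv c2 = F2 + B * c2 - P * k2"
    by (simp_all add: F1_def F2_def partner_cofactor_def)
  have d: "pderiv S1 = pderiv P * F1 + P * pderiv F1 - pderiv A * pderiv P * c1
              - A * pderiv (pderiv P) * c1 - pderiv P * (A * pderiv c1)"
          "pderiv S2 = pderiv P * F2 + P * pderiv F2 - pderiv A * pderiv P * c2
              - A * pderiv (pderiv P) * c2 - pderiv P * (A * pderiv c2)"
    by (simp_all add: S1_def S2_def partner_poly_def F1_def F2_def pderiv_mult pderiv_diff algebra_simps)
  have PR: "P * R = S1 * pderiv S2 - pderiv S1 * S2"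
    unfolding d e1 e2 unfolding R_def S1_def S2_def partner_poly_def F1_def[symmetric] F2_def[symmetric]
      Z1_def Z2_def L_def by algebra
  have "P * wronskian_poly A B A B P c1 k1 c2 k2 = P * (A\<^sup>2 * R)"
    unfolding wronskian_poly_factor S1_def[symmetric] S2_def[symmetric]
    using PR by algebra
  with assms(1) have "wronskian_poly A B A B P c1 k1 c2 k2 = A\<^sup>2 * R"
    by simp
  thus ?thesis using PR that by blast
qed

section \<open>Divided differences under a linear functional\<close>

text \<open>
  The quotient \<open>(p(t) - p(z)) / (t - z)\<close>, as a polynomial in \<open>t\<close>, is \<open>synthetic_div p z\<close>. Its
  coefficients are polynomials in \<open>z\<close>, hence so is its image under any linear functional. This is
  the way in which integrals over \<open>t\<close> produce polynomials in \<open>z\<close>.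
\<close>

lemma functional_synthetic_div_is_poly:
  fixes I :: "complex poly \<Rightarrow> complex"
  assumes "\<And>p q. I (p + q) = I p + I q" and "\<And>c p. I (smult c p) = c * I p"
  shows "\<exists>K. \<forall>z. poly K z = I (synthetic_div p z)"
  using assms
proof (induction p arbitrary: I)
  case 0
  have "I 0 = 0" using 0(2)[of 0 0] by simp
  then show ?case by (intro exI[of _ 0]) simp
next
  case (pCons a p)
  have "I (pCons 0 (q + r)) = I (pCons 0 q) + I (pCons 0 r)" for q r
    using pCons.prems(1)[of "pCons 0 q" "pCons 0 r"] by simp
  moreover have "I (pCons 0 (smult c q)) = c * I (pCons 0 q)" for c q
    using pCons.prems(2)[of c "pCons 0 q"] by simp
  ultimately obtain K where K: "poly K z = I (pCons 0 (synthetic_div p z))" for z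
    using pCons.IH[of "\<lambda>q. I (pCons 0 q)"] by auto
  have "I (synthetic_div (pCons a p) z) = poly (smult (I 1) p + K) z" for z
  proof -
    have "synthetic_div (pCons a p) z = smult (poly p z) 1 + pCons 0 (synthetic_div p z)"
      by simp
    then show ?thesis by (simp only: pCons.prems K poly_add poly_smult) simp
  qed
  then show ?case by metis
qed

lemma poly_eq_synthetic_div:
  fixes p :: "'a::comm_ring_1 poly"
  shows "poly p t = (t - z) * poly (synthetic_div p z) t + poly p z"
proof -
  have "poly p t = poly ([:-z, 1:] * synthetic_div p z + [:poly p z:]) t"
    by (simp only: synthetic_div_correct')
  then show ?thesis by (simp add: algebra_simps)
qed

text \<open>
  Combined with \<open>poly_eq_synthetic_div\<close> this is the expansion
  \<open>p(z) = p(t) - (t - z) p'(t) + (t - z)\<^sup>2 s'(t)\<close> with \<open>s = synthetic_div p z\<close>: the second order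
  remainder is a derivative in \<open>t\<close> of the divided difference.
\<close>

lemma poly_pderiv_eq_synthetic_div:
  fixes p :: "'a::idom poly"
  shows "poly (pderiv p) t =
    poly (synthetic_div p z) t + (t - z) * poly (pderiv (synthetic_div p z)) t"
proof -
  have "pderiv p = pderiv ([:-z, 1:] * synthetic_div p z + [:poly p z:])"
    by (simp only: synthetic_div_correct')
  also have "\<dots> = synthetic_div p z + [:-z, 1:] * pderiv (synthetic_div p z)"
    by (simp only: pderiv_mult pderiv_add) (simp add: pderiv_pCons)
  finally have "poly (pderiv p) t =
      poly (synthetic_div p z + [:-z, 1:] * pderiv (synthetic_div p z)) t" by simp
  then show ?thesis by (simp add: algebra_simps)
qed

section \<open>Boundary values of a branch of the weight\<close>

text \<open>
  A boundary value of \<open>exp (\<integral> B/A)\<close> inherits the equation \<open>w' = (B/A) w\<close>. Around a point of the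
  interval \<open>B/A\<close> has a primitive \<open>G\<close> on a full disc, because \<open>A\<close> has no zero there. On the upper half
  of the disc \<open>F - G\<close> is constant, so that \<open>c W = C exp G\<close> there; letting \<open>z\<close> tend to the real axis,
  \<open>w = C exp G\<close> on the real diameter.
\<close>

lemma boundary_value_has_derivative:
  assumes branch: "exp_branch A B U W"
    and x0: "x0 \<in> einterval a b"
    and nz: "\<forall>x\<in>einterval a b. poly A x \<noteq> 0"
    and nbhd: "\<forall>x\<in>einterval a b.
      \<forall>\<^sub>F z in at (complex_of_real x) within {z. Im z > 0}. z \<in> U"
    and lim: "\<forall>x\<in>einterval a b.
      ((\<lambda>z. c * W z) \<longlongrightarrow> complex_of_real (w x)) (at (complex_of_real x) within {z. Im z > 0})"
  shows "(w has_real_derivative poly B x0 / poly A x0 * w x0) (at x0)"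
proof -
  obtain F where F: "\<And>z. z \<in> U \<Longrightarrow> (F has_field_derivative poly (cpoly B) z / poly (cpoly A) z) (at z)"
    "\<And>z. z \<in> U \<Longrightarrow> W z = exp (F z)"
    using branch unfolding exp_branch_def by blast
  define f where "f z = poly (cpoly B) z / poly (cpoly A) z" for z
  obtain r1 where r1: "r1 > 0" "\<And>x. \<bar>x - x0\<bar> < r1 \<Longrightarrow> x \<in> einterval a b"
    using open_einterval[of a b] x0 unfolding open_dist dist_real_def by metis
  obtain r2 where r2: "r2 > 0" "\<And>z. Im z > 0 \<Longrightarrow> dist z (of_real x0) < r2 \<Longrightarrow> z \<in> U"
    using nbhd[rule_format, OF x0] unfolding eventually_at by force
  have "poly (cpoly A) (of_real x0) \<noteq> 0"
    using nz x0 by (simp add: poly_cpoly_of_real)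
  moreover have "open {z. poly (cpoly A) z \<noteq> 0}"
    by (intro open_Collect_neq continuous_intros)
  ultimately obtain r3 where r3: "r3 > 0"
    "\<And>z. dist z (of_real x0) < r3 \<Longrightarrow> poly (cpoly A) z \<noteq> 0"
    unfolding open_dist by force
  define r where "r = min r1 (min r2 r3)"
  have r: "r > 0" "r \<le> r1" "r \<le> r2" "r \<le> r3" using r1 r2 r3 by (auto simp: r_def)
  let ?D = "ball (complex_of_real x0) r"
  have nzD: "poly (cpoly A) z \<noteq> 0" if "z \<in> ?D" for z
    using that r r3(2)[of z] by (auto simp: dist_commute)
  have "f holomorphic_on ?D"
    unfolding f_def using nzD by (intro holomorphic_intros) (auto simp: poly_holomorphic_on)
  then obtain G where G': "\<And>z. z \<in> ?D \<Longrightarrow> (G has_field_derivative f z) (at z within ?D)"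
    using holomorphic_convex_primitive'[of ?D f] by auto
  have G: "(G has_field_derivative f z) (at z)" if "z \<in> ?D" for z
    using G'[OF that] that by (metis at_within_open open_ball)
  let ?H = "?D \<inter> {z. Im z > 0}"
  have HU: "z \<in> U" if "z \<in> ?H" for z
    using that r r2(2)[of z] by (auto simp: dist_commute)
  have "\<exists>k. \<forall>z\<in>?H. F z - G z = k"
  proof (rule has_field_derivative_zero_constant)
    show "convex ?H" by (intro convex_Int convex_ball convex_halfspace_Im_gt)
    fix z assume "z \<in> ?H"
    then show "((\<lambda>z. F z - G z) has_field_derivative 0) (at z within ?H)"
      using F(1)[OF HU[of z]] G[of z]
      by (auto simp: f_def intro!: derivative_eq_intros intro: has_field_derivative_at_within)
  qed
  then obtain k where k: "\<And>z. z \<in> ?H \<Longrightarrow> F z = k + G z" by (metis diff_add_cancel)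
  define C where "C = c * exp k"
  have WC: "c * W z = C * exp (G z)" if "z \<in> ?H" for z
    using F(2)[OF HU[OF that]] k[OF that] by (simp add: C_def exp_add)
  have val: "complex_of_real (w x) = C * exp (G (of_real x))" if x: "\<bar>x - x0\<bar> < r" for x
  proof (rule tendsto_unique)
    have xD: "complex_of_real x \<in> ?D"
      using x by (simp add: dist_real_def dist_of_real abs_minus_commute)
    show "at (complex_of_real x) within {z. Im z > 0} \<noteq> bot"
    proof -
      have "complex_of_real x islimpt {z. Im z > 0}"
        unfolding islimpt_approachable
      proof (intro allI impI)
        fix e :: real assume "e > 0"
        then show "\<exists>z\<in>{z. Im z > 0}. z \<noteq> complex_of_real x \<and> dist z (complex_of_real x) < e"
          by (intro bexI[of _ "Complex x (e / 2)"])
             (auto simp: dist_norm complex_of_real_def complex_eq_iff norm_complex_def)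
      qed
      then show ?thesis by (simp add: trivial_limit_within)
    qed
    show "((\<lambda>z. c * W z) \<longlongrightarrow> complex_of_real (w x)) (at (of_real x) within {z. Im z > 0})"
      using lim r1(2)[of x] x r by auto
    have "((\<lambda>z. C * exp (G z)) \<longlongrightarrow> C * exp (G (of_real x))) (at (complex_of_real x))"
      using G[OF xD] by (intro tendsto_intros) (metis DERIV_isCont isCont_def)
    then have "((\<lambda>z. C * exp (G z)) \<longlongrightarrow> C * exp (G (of_real x)))
        (at (complex_of_real x) within {z. Im z > 0})"
      by (rule tendsto_within_subset) auto
    moreover have "\<forall>\<^sub>F z in at (complex_of_real x) within {z. Im z > 0}. C * exp (G z) = c * W z"
    proof -
      have "\<forall>\<^sub>F z in nhds (complex_of_real x). z \<in> ?D"
        using xD by (intro eventually_nhds_in_open) auto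
      then show ?thesis
        unfolding eventually_at_filter by eventually_elim (simp add: WC)
    qed
    ultimately show "((\<lambda>z. c * W z) \<longlongrightarrow> C * exp (G (of_real x)))
        (at (complex_of_real x) within {z. Im z > 0})"
      by (rule Lim_transform_eventually)
  qed
  have "((\<lambda>x. complex_of_real (w x)) has_vector_derivative
      C * exp (G (of_real x0)) * f (of_real x0)) (at x0)"
  proof (rule has_vector_derivative_transform_within_open)
    show "((\<lambda>x. C * exp (G (of_real x))) has_vector_derivative
      C * exp (G (of_real x0)) * f (of_real x0)) (at x0)"
      using r(1) by (auto intro!: has_vector_derivative_real_field derivative_eq_intros G)
    show "open {x0 - r<..<x0 + r}" by simp
    show "x0 \<in> {x0 - r<..<x0 + r}" using r by simp
    show "C * exp (G (of_real x)) = complex_of_real (w x)" if "x \<in> {x0 - r<..<x0 + r}" for x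
      using that val[of x] by auto
  qed
  also have "C * exp (G (of_real x0)) * f (of_real x0) =
      complex_of_real (poly B x0 / poly A x0 * w x0)"
    using val[of x0] r(1) by (simp add: f_def poly_cpoly_of_real)
  finally show ?thesis
    using has_vector_derivative_complex_iff[of "\<lambda>x. complex_of_real (w x)"]
    by (simp add: o_def has_real_derivative_iff_has_vector_derivative)
qed

section \<open>Integrals of derivatives over open intervals\<close>

lemma primitive_variation_le_integral:
  fixes f F F' :: "real \<Rightarrow> real"
  assumes f: "set_integrable lborel S f"
    and sub: "closed_segment x y \<subseteq> S"
    and der: "\<And>t. t \<in> closed_segment x y \<Longrightarrow> (F has_real_derivative F' t) (at t)"
    and cont: "continuous_on (closed_segment x y) F'"
    and le: "\<And>t. t \<in> closed_segment x y \<Longrightarrow> \<bar>F' t\<bar> \<le> \<bar>f t\<bar>"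
  shows "\<bar>F y - F x\<bar> \<le> (LINT t:S|lborel. \<bar>f t\<bar>)"
  using sub der cont le
proof (induction x y rule: linorder_wlog)
  case (le x y)
  then have seg: "closed_segment x y = {x..y}" by (simp add: closed_segment_eq_real_ivl)
  have "F y - F x = (LINT t:{x..y}|lborel. F' t)"
    unfolding set_lebesgue_integral_def
    using le by (intro integral_FTC_atLeastAtMost[symmetric])
      (auto simp: seg has_real_derivative_iff_has_vector_derivative[symmetric]
         intro: has_field_derivative_at_within)
  also have "\<bar>\<dots>\<bar> \<le> (LINT t:{x..y}|lborel. \<bar>F' t\<bar>)"
    using le set_integral_norm_bound[of lborel "{x..y}" F']
    by (simp add: seg borel_integrable_atLeastAtMost')
  also have "\<dots> \<le> (LINT t:S|lborel. \<bar>f t\<bar>)"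
    unfolding set_lebesgue_integral_def
  proof (rule integral_mono)
    show "integrable lborel (\<lambda>t. indicat_real {x..y} t *\<^sub>R \<bar>F' t\<bar>)"
      using le borel_integrable_atLeastAtMost'[of x y "\<lambda>t. \<bar>F' t\<bar>"]
      by (simp add: seg set_integrable_def continuous_on_rabs)
    show "integrable lborel (\<lambda>t. indicat_real S t *\<^sub>R \<bar>f t\<bar>)"
      using set_integrable_norm[OF f] by (simp add: set_integrable_def)
  qed (use le in \<open>auto simp: seg indicator_def\<close>)
  finally show ?case .
next
  case (sym x y)
  then show ?case by (simp add: closed_segment_commute abs_minus_commute)
qed

text \<open>
  If \<open>|f|\<close> dominates \<open>\<kappa> / |y - \<beta>|\<close> up to \<open>\<beta>\<close>, its integral dominates the variation of
  \<open>\<kappa> ln |y - \<beta>|\<close>, which is unbounded. Phrased with segments, this serves left and right endpoints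
  alike.
\<close>

lemma not_integrable_near_pole:
  fixes f :: "real \<Rightarrow> real"
  assumes f: "set_integrable lborel S f" and "t0 \<noteq> \<beta>" and "\<kappa> > 0"
    and S: "\<And>y. y \<in> closed_segment t0 \<beta> \<Longrightarrow> y \<noteq> \<beta> \<Longrightarrow> y \<in> S"
    and ge: "\<And>y. y \<in> closed_segment t0 \<beta> \<Longrightarrow> y \<noteq> \<beta> \<Longrightarrow> \<kappa> \<le> \<bar>f y\<bar> * \<bar>y - \<beta>\<bar>"
  shows False
proof -
  define I where "I = (LINT t:S|lborel. \<bar>f t\<bar>)"
  have I: "I \<ge> 0" unfolding I_def set_lebesgue_integral_def by (intro Bochner_Integration.integral_nonneg) auto
  define K where "K = (I + 1) / \<kappa>"
  have K: "K > 0" and \<kappa>K: "\<kappa> * K = I + 1" using I \<open>\<kappa> > 0\<close> by (simp_all add: K_def)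
  \<comment> \<open>On the way from \<open>t0\<close> to \<open>y = \<beta> + D\<close> the function \<open>ln |y - \<beta>|\<close> decreases by exactly \<open>K\<close>.\<close>
  define D where "D = (t0 - \<beta>) * exp (- K)"
  define y where "y = \<beta> + D"
  have e: "0 < exp (- K)" "exp (- K) < 1" using K by auto
  have y: "y \<noteq> \<beta>" using \<open>t0 \<noteq> \<beta>\<close> by (simp add: y_def D_def)
  have seg: "t \<in> closed_segment t0 \<beta> \<and> t \<noteq> \<beta>" if "t \<in> closed_segment t0 y" for t
  proof (cases "t0 < \<beta>")
    case True
    have "t0 - \<beta> \<le> D"
      using True e mult_left_mono_neg[of "exp (- K)" 1 "t0 - \<beta>"] by (simp add: D_def)
    moreover have "D < 0" using True e by (simp add: D_def mult_less_0_iff)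
    ultimately have "t0 \<le> y \<and> y < \<beta>" unfolding y_def by simp
    then show ?thesis using that by (auto simp: closed_segment_eq_real_ivl)
  next
    case False
    have "D \<le> t0 - \<beta>"
      using False e mult_left_mono[of "exp (- K)" 1 "t0 - \<beta>"] by (simp add: D_def)
    moreover have "D > 0" using False e \<open>t0 \<noteq> \<beta>\<close> by (simp add: D_def)
    ultimately have "y \<le> t0 \<and> \<beta> < y" unfolding y_def by simp
    then show ?thesis using that by (auto simp: closed_segment_eq_real_ivl split: if_splits)
  qed
  have "\<bar>\<kappa> * ln \<bar>y - \<beta>\<bar> - \<kappa> * ln \<bar>t0 - \<beta>\<bar>\<bar> \<le> I"
    unfolding I_def
  proof (rule primitive_variation_le_integral[OF f, where F = "\<lambda>t. \<kappa> * ln \<bar>t - \<beta>\<bar>" and F' = "\<lambda>t. \<kappa> / (t - \<beta>)"])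
    show "closed_segment t0 y \<subseteq> S" using seg S by auto
    show "continuous_on (closed_segment t0 y) (\<lambda>t. \<kappa> / (t - \<beta>))"
      using seg by (intro continuous_intros) auto
    fix t assume t: "t \<in> closed_segment t0 y"
    show "((\<lambda>t. \<kappa> * ln \<bar>t - \<beta>\<bar>) has_real_derivative \<kappa> / (t - \<beta>)) (at t)"
    proof (cases "t < \<beta>")
      case True
      have "((\<lambda>t. \<kappa> * ln (\<beta> - t)) has_real_derivative \<kappa> / (t - \<beta>)) (at t)"
        using True by (auto intro!: derivative_eq_intros simp: field_simps)
      then show ?thesis
        by (rule has_field_derivative_transform_within_open[where S="{..<\<beta>}"]) (use True in auto)
    next
      case False
      then have "t > \<beta>" using seg[OF t] by auto
      have "((\<lambda>t. \<kappa> * ln (t - \<beta>)) has_real_derivative \<kappa> / (t - \<beta>)) (at t)"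
        using \<open>t > \<beta>\<close> by (auto intro!: derivative_eq_intros simp: field_simps)
      then show ?thesis
        by (rule has_field_derivative_transform_within_open[where S="{\<beta><..}"]) (use \<open>t > \<beta>\<close> in auto)
    qed
    show "\<bar>\<kappa> / (t - \<beta>)\<bar> \<le> \<bar>f t\<bar>"
      using ge[of t] seg[OF t] \<open>\<kappa> > 0\<close> by (simp add: abs_divide divide_le_eq)
  qed
  moreover have "ln \<bar>y - \<beta>\<bar> = ln \<bar>t0 - \<beta>\<bar> - K"
    using \<open>t0 \<noteq> \<beta>\<close> by (simp add: y_def D_def abs_mult ln_mult)
  ultimately have "\<kappa> * K \<le> I" using K \<open>\<kappa> > 0\<close> by (simp add: algebra_simps abs_le_iff)
  then show False using \<kappa>K by simp
qed

text \<open>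
  The sign \<open>s\<close> is the direction of the half-line that starts at \<open>t0\<close>.
\<close>

lemma not_integrable_near_infinity:
  fixes f :: "real \<Rightarrow> real"
  assumes f: "set_integrable lborel S f" and "\<kappa> > 0" and s: "s = 1 \<or> s = -1"
    and S: "\<And>K. K \<ge> 0 \<Longrightarrow> t0 + s * K \<in> S"
    and ge: "\<And>K. K \<ge> 0 \<Longrightarrow> \<kappa> \<le> \<bar>f (t0 + s * K)\<bar>"
  shows False
proof -
  define I where "I = (LINT t:S|lborel. \<bar>f t\<bar>)"
  have I: "I \<ge> 0" unfolding I_def set_lebesgue_integral_def by (intro Bochner_Integration.integral_nonneg) auto
  define K where "K = (I + 1) / \<kappa>"
  have K: "K > 0" and \<kappa>K: "\<kappa> * K = I + 1" using I \<open>\<kappa> > 0\<close> by (simp_all add: K_def)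
  have seg: "\<exists>L\<ge>0. t = t0 + s * L" if "t \<in> closed_segment t0 (t0 + s * K)" for t
    using that s K by (intro exI[of _ "s * (t - t0)"]) (auto simp: closed_segment_eq_real_ivl split: if_splits)
  have "\<bar>\<kappa> * (t0 + s * K) - \<kappa> * t0\<bar> \<le> I"
    unfolding I_def
  proof (rule primitive_variation_le_integral[OF f, where F = "\<lambda>t. \<kappa> * t" and F' = "\<lambda>t. \<kappa>"])
    fix t assume t: "t \<in> closed_segment t0 (t0 + s * K)"
    show "((\<lambda>t. \<kappa> * t) has_real_derivative \<kappa>) (at t)" by (auto intro!: derivative_eq_intros)
    show "\<bar>\<kappa>\<bar> \<le> \<bar>f t\<bar>" using seg[OF t] ge \<open>\<kappa> > 0\<close> by auto
  next
    show "closed_segment t0 (t0 + s * K) \<subseteq> S" using seg S by blast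
  qed simp
  moreover have "\<bar>\<kappa> * (t0 + s * K) - \<kappa> * t0\<bar> = \<kappa> * K"
    using s K \<open>\<kappa> > 0\<close> by (auto simp: algebra_simps abs_mult)
  ultimately have "\<kappa> * K \<le> I" by linarith
  then show False using \<kappa>K by simp
qed

text \<open>
  Smallness of \<open>G\<close> at points arbitrarily close to the ends suffices: along a sequence of such points
  the boundary terms tend to \<open>0\<close>, and the integral over the whole interval is the limit by dominated
  convergence.
\<close>

lemma integral_derivative_eq_0:
  fixes G g :: "real \<Rightarrow> complex"
  assumes "a < b"
    and g: "set_integrable lborel (einterval a b) g"
    and G: "\<And>t. t \<in> einterval a b \<Longrightarrow> (G has_vector_derivative g t) (at t)"
    and cont: "continuous_on (einterval a b) g"
    and upper: "\<And>t0 e. t0 \<in> einterval a b \<Longrightarrow> e > 0 \<Longrightarrow> \<exists>y\<ge>t0. ereal y < b \<and> norm (G y) < e"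
    and lower: "\<And>t0 e. t0 \<in> einterval a b \<Longrightarrow> e > 0 \<Longrightarrow> \<exists>y\<le>t0. a < ereal y \<and> norm (G y) < e"
  shows "(LINT t:einterval a b|lborel. g t) = 0"
proof -
  obtain u l :: "nat \<Rightarrow> real" where ul: "einterval a b = (\<Union>i. {l i..u i})"
    "incseq u" "decseq l" "\<And>i. l i < u i" "\<And>i. a < ereal (l i)" "\<And>i. ereal (u i) < b"
    "(\<lambda>i. ereal (l i)) \<longlonglongrightarrow> a" "(\<lambda>i. ereal (u i)) \<longlonglongrightarrow> b"
    by (rule einterval_Icc_approximation[OF \<open>a < b\<close>]) (rule that)
  have ulI: "u i \<in> einterval a b" "l i \<in> einterval a b" for i
    using ul(4)[of i] unfolding ul(1) by (auto intro: exI[of _ i])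
  have "\<exists>y\<ge>u n. ereal y < b \<and> norm (G y) < 1 / Suc n" for n
    using upper[OF ulI(1)] by auto
  then obtain y where y: "\<And>n. y n \<ge> u n" "\<And>n. ereal (y n) < b" "\<And>n. norm (G (y n)) < 1 / Suc n"
    by metis
  have "\<exists>x\<le>l n. a < ereal x \<and> norm (G x) < 1 / Suc n" for n
    using lower[OF ulI(2)] by auto
  then obtain x where x: "\<And>n. x n \<le> l n" "\<And>n. a < ereal (x n)" "\<And>n. norm (G (x n)) < 1 / Suc n"
    by metis
  have xy: "x n \<le> y n" "{x n..y n} \<subseteq> einterval a b" for n
  proof -
    show "x n \<le> y n" using x(1)[of n] y(1)[of n] ul(4)[of n] by linarith
    show "{x n..y n} \<subseteq> einterval a b"
    proof
      fix t assume "t \<in> {x n..y n}"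
      then have "ereal (x n) \<le> ereal t" "ereal t \<le> ereal (y n)" by auto
      with x(2)[of n] y(2)[of n] show "t \<in> einterval a b"
        unfolding einterval_iff by (metis le_less_trans less_le_trans)
    qed
  qed
  have FTC: "(LINT t:{x n..y n}|lborel. g t) = G (y n) - G (x n)" for n
    unfolding set_lebesgue_integral_def
  proof (rule integral_FTC_atLeastAtMost[OF xy(1)])
    show "continuous_on {x n..y n} g" by (rule continuous_on_subset[OF cont xy(2)])
    show "(G has_vector_derivative g t) (at t within {x n..y n})" if "x n \<le> t" "t \<le> y n" for t
      using that xy(2)[of n] by (intro has_vector_derivative_at_within[OF G]) auto
  qed
  have "(\<lambda>n. LINT t:{x n..y n}|lborel. g t) \<longlonglongrightarrow> (LINT t:einterval a b|lborel. g t)"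
    unfolding set_lebesgue_integral_def
  proof (rule integral_dominated_convergence)
    show "integrable lborel (\<lambda>t. norm (indicat_real (einterval a b) t *\<^sub>R g t))"
      using g unfolding set_integrable_def by (rule integrable_norm)
    show "(\<lambda>t. indicat_real (einterval a b) t *\<^sub>R g t) \<in> borel_measurable lborel"
      using g unfolding set_integrable_def by auto
    show "(\<lambda>t. indicat_real {x n..y n} t *\<^sub>R g t) \<in> borel_measurable lborel" for n
    proof -
      have "set_integrable lborel {x n..y n} g"
        by (rule set_integrable_subset[OF g]) (use xy in auto)
      then show ?thesis unfolding set_integrable_def by auto
    qed
    show "AE t in lborel. norm (indicat_real {x n..y n} t *\<^sub>R g t)
        \<le> norm (indicat_real (einterval a b) t *\<^sub>R g t)" for n
      using xy(2)[of n] by (intro AE_I2) (auto simp: indicator_def)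
    show "AE t in lborel. (\<lambda>n. indicat_real {x n..y n} t *\<^sub>R g t)
        \<longlonglongrightarrow> indicat_real (einterval a b) t *\<^sub>R g t"
    proof (intro AE_I2 tendsto_eventually)
      fix t
      show "\<forall>\<^sub>F n in sequentially. indicat_real {x n..y n} t *\<^sub>R g t = indicat_real (einterval a b) t *\<^sub>R g t"
      proof (cases "t \<in> einterval a b")
        case True
        then obtain i where i: "l i \<le> t" "t \<le> u i" using ul(1) by auto
        have "t \<in> {x n..y n}" if "n \<ge> i" for n
          using i x(1)[of n] y(1)[of n] incseqD[OF ul(2) that] decseqD[OF ul(3) that] by auto
        then show ?thesis using True by (intro eventually_sequentiallyI[of i]) auto
      next
        case False
        then have "t \<notin> {x n..y n}" for n using xy(2)[of n] by blast
        then show ?thesis using False by auto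
      qed
    qed
  qed
  moreover have "(\<lambda>n. LINT t:{x n..y n}|lborel. g t) \<longlonglongrightarrow> 0 - 0"
    unfolding FTC
  proof (intro tendsto_diff)
    have lim: "(\<lambda>n. 1 / real (Suc n)) \<longlonglongrightarrow> 0"
      using LIMSEQ_inverse_real_of_nat by (simp add: inverse_eq_divide)
    show "(\<lambda>n. G (y n)) \<longlonglongrightarrow> 0"
      by (rule Lim_null_comparison[OF _ lim]) (intro always_eventually allI less_imp_le y(3))
    show "(\<lambda>n. G (x n)) \<longlonglongrightarrow> 0"
      by (rule Lim_null_comparison[OF _ lim]) (intro always_eventually allI less_imp_le x(3))
  qed
  ultimately show ?thesis using LIMSEQ_unique by fastforce
qed

section \<open>A single semiclassical weight\<close>

locale semiclassical =
  fixes A B :: "real poly" and J :: "(ereal \<times> ereal) set" and w :: "real \<Rightarrow> real"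
  assumes weight: "semiclassical_weight A B J w"
begin

abbreviation supp :: "real set" where "supp \<equiv> support_set J"

lemma finite_intervals: "finite J"
  using weight by (simp add: semiclassical_weight_def admissible_intervals_def)

lemma interval_props:
  assumes "(a, b) \<in> J"
  shows "a < b" and "a = -\<infinity> \<or> (\<exists>x. a = ereal x \<and> poly A x = 0)"
    and "b = \<infinity> \<or> (\<exists>x. b = ereal x \<and> poly A x = 0)"
    and "\<forall>x\<in>einterval a b. poly A x \<noteq> 0"
proof -
  have "\<forall>(a, b)\<in>J. a < b \<and>
        (a = -\<infinity> \<or> (\<exists>x. a = ereal x \<and> poly A x = 0)) \<and>
        (b = \<infinity> \<or> (\<exists>x. b = ereal x \<and> poly A x = 0)) \<and>
        (\<forall>x\<in>einterval a b. poly A x \<noteq> 0)"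
    using weight unfolding semiclassical_weight_def admissible_intervals_def by (elim conjE)
  note props = bspec[OF this assms, unfolded prod.case]
  show "a < b" using props by (elim conjE)
  show "a = -\<infinity> \<or> (\<exists>x. a = ereal x \<and> poly A x = 0)" using props by (elim conjE)
  show "b = \<infinity> \<or> (\<exists>x. b = ereal x \<and> poly A x = 0)" using props by (elim conjE)
  show "\<forall>x\<in>einterval a b. poly A x \<noteq> 0" using props by (elim conjE)
qed

lemma einterval_subset_supp: "(a, b) \<in> J \<Longrightarrow> einterval a b \<subseteq> supp"
  unfolding support_set_def by (rule order_trans[OF _ UN_upper[of "(a, b)"]]) (auto simp: einterval_def)

lemma closed_supp: "closed supp"
  unfolding support_set_def
proof (intro closed_UN finite_intervals ballI)
  fix I assume "I \<in> J"
  obtain a b where [simp]: "I = (a, b)" by (cases I)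
  show "closed (case I of (a, b) \<Rightarrow> {x. a \<le> ereal x \<and> ereal x \<le> b})"
    by (auto intro!: closed_Collect_conj closed_Collect_le continuous_intros)
qed

lemma supp_borel [measurable]: "supp \<in> sets borel"
  using closed_supp by simp

text \<open>
  The weight is controlled on the open intervals only. Finitely many endpoints are missing from the
  support, so that all integrals can be taken over this set.
\<close>

definition interiors :: "real set" where "interiors = (\<Union>(a, b)\<in>J. einterval a b)"

lemma interiors_subset_supp: "interiors \<subseteq> supp"
  using einterval_subset_supp by (auto simp: interiors_def)

lemma finite_supp_minus_interiors: "finite (supp - interiors)"
proof (rule finite_subset)
  show "supp - interiors \<subseteq> real_of_ereal ` (fst ` J \<union> snd ` J)"
  proof
    fix x assume x: "x \<in> supp - interiors"
    then obtain a b where ab: "(a, b) \<in> J" "a \<le> ereal x" "ereal x \<le> b"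
      by (auto simp: support_set_def)
    then have "x \<notin> einterval a b" using x by (auto simp: interiors_def)
    then have "a = ereal x \<or> b = ereal x" using ab by (auto simp: einterval_def)
    then have "x = real_of_ereal a \<or> x = real_of_ereal b" by auto
    then show "x \<in> real_of_ereal ` (fst ` J \<union> snd ` J)" using ab(1) by force
  qed
qed (use finite_intervals in auto)

lemma weight_branch:
  assumes "(a, b) \<in> J"
  obtains U W c where "exp_branch A B U W" and "\<And>x. x \<in> einterval a b \<Longrightarrow> w x > 0"
    and "\<forall>x\<in>einterval a b. \<forall>\<^sub>F z in at (complex_of_real x) within {z. Im z > 0}. z \<in> U"
    and "\<forall>x\<in>einterval a b. ((\<lambda>z. c * W z) \<longlongrightarrow> complex_of_real (w x))
           (at (complex_of_real x) within {z. Im z > 0})"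
proof -
  have "weight_on A B J w" using weight by (simp add: semiclassical_weight_def)
  from bspec[OF this[unfolded weight_on_def] assms, unfolded prod.case]
  obtain U W c where "exp_branch A B U W \<and> c \<noteq> 0 \<and> (\<forall>x\<in>einterval a b. w x > 0 \<and>
      (\<forall>\<^sub>F z in at (complex_of_real x) within {z. Im z > 0}. z \<in> U) \<and>
      ((\<lambda>z. c * W z) \<longlongrightarrow> complex_of_real (w x)) (at (complex_of_real x) within {z. Im z > 0}))"
    by (elim exE) (rule that)
  note c = this
  have branch: "exp_branch A B U W" using c by (elim conjE)
  have props: "\<forall>x\<in>einterval a b. w x > 0 \<and>
      (\<forall>\<^sub>F z in at (complex_of_real x) within {z. Im z > 0}. z \<in> U) \<and>
      ((\<lambda>z. c * W z) \<longlongrightarrow> complex_of_real (w x)) (at (complex_of_real x) within {z. Im z > 0})"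
    using c by (elim conjE)
  show thesis
    by (rule that[OF branch bspec[OF props, THEN conjunct1]
          ballI[OF bspec[OF props, THEN conjunct2, THEN conjunct1]]
          ballI[OF bspec[OF props, THEN conjunct2, THEN conjunct2]]])
qed

lemma weight_pos: "x \<in> interiors \<Longrightarrow> w x > 0"
  unfolding interiors_def by (auto elim: weight_branch)

lemma weight_has_derivative:
  assumes ab: "(a, b) \<in> J" and x: "x \<in> einterval a b"
  shows "(w has_real_derivative poly B x / poly A x * w x) (at x)"
proof -
  obtain U W c where "exp_branch A B U W"
    and "\<forall>x\<in>einterval a b. \<forall>\<^sub>F z in at (complex_of_real x) within {z. Im z > 0}. z \<in> U"
    and "\<forall>x\<in>einterval a b. ((\<lambda>z. c * W z) \<longlongrightarrow> complex_of_real (w x))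
           (at (complex_of_real x) within {z. Im z > 0})"
    by (rule weight_branch[OF ab]) (rule that)
  then show ?thesis
    by (rule boundary_value_has_derivative[OF _ x interval_props(4)[OF ab]])
qed

lemma set_integrable_monomial: "set_integrable lborel supp (\<lambda>t. complex_of_real (t ^ m * w t))"
proof -
  have key: "set_integrable lborel supp (\<lambda>t. \<bar>t\<bar> ^ m * w t)" for m
  proof -
    have "integrable lborel (\<lambda>t. indicat_real supp t *\<^sub>R (\<bar>t\<bar> ^ m * \<bar>w t\<bar>))"
      using weight unfolding semiclassical_weight_def set_integrable_def by blast
    also have "?this \<longleftrightarrow> integrable lborel (\<lambda>t. indicat_real supp t *\<^sub>R (\<bar>t\<bar> ^ m * w t))"
    proof (rule integrable_discrete_difference[of "supp - interiors"])
      show "countable (supp - interiors)"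
        using finite_supp_minus_interiors by (rule countable_finite)
      show "indicat_real supp t *\<^sub>R (\<bar>t\<bar> ^ m * \<bar>w t\<bar>) = indicat_real supp t *\<^sub>R (\<bar>t\<bar> ^ m * w t)"
        if "t \<notin> supp - interiors" for t
        using that weight_pos[of t] by (auto simp: indicator_def)
    qed auto
    finally show ?thesis unfolding set_integrable_def .
  qed
  have [measurable]: "(\<lambda>t. indicat_real supp t * w t) \<in> borel_measurable borel"
    using key[of 0] by (auto simp: set_integrable_def dest: borel_measurable_integrable)
  have "integrable lborel (\<lambda>t. complex_of_real (t ^ m * (indicat_real supp t * w t)))"
  proof (rule Bochner_Integration.integrable_bound)
    show "integrable lborel (\<lambda>t. indicat_real supp t *\<^sub>R (\<bar>t\<bar> ^ m * w t))"
      using key[of m] unfolding set_integrable_def .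
    show "(\<lambda>t. complex_of_real (t ^ m * (indicat_real supp t * w t))) \<in> borel_measurable lborel"
      by measurable
  qed (auto simp: abs_mult norm_mult norm_power)
  then show ?thesis
    unfolding set_integrable_def
    by (rule back_subst[of "integrable lborel"]) (auto simp: indicator_def)
qed

lemma set_integrable_poly:
  "set_integrable lborel supp (\<lambda>t. poly p (complex_of_real t) * complex_of_real (w t))"
proof -
  have "integrable lborel (\<lambda>t. \<Sum>i\<le>degree p.
      coeff p i * (indicat_real supp t *\<^sub>R complex_of_real (t ^ i * w t)))"
    using set_integrable_monomial unfolding set_integrable_def
    by (intro Bochner_Integration.integrable_sum integrable_mult_right) auto
  also have "(\<lambda>t. \<Sum>i\<le>degree p. coeff p i * (indicat_real supp t *\<^sub>R complex_of_real (t ^ i * w t))) =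
      (\<lambda>t. indicat_real supp t *\<^sub>R (poly p (complex_of_real t) * complex_of_real (w t)))"
    by (auto simp: poly_altdef sum_distrib_left sum_distrib_right mult_ac indicator_def fun_eq_iff)
  finally show ?thesis unfolding set_integrable_def .
qed

lemma set_integrable_weight: "set_integrable lborel supp w"
  and set_integrable_A_weight: "set_integrable lborel supp (\<lambda>t. poly A t * w t)"
proof -
  have "set_integrable lborel supp (\<lambda>t. Re (complex_of_real (poly p t * w t)))" for p
    using set_integrable_poly[of "cpoly p"] unfolding set_integrable_def
    by (simp add: poly_cpoly_of_real) (drule integrable_Re, simp)
  from this[of 1] this[of A] show "set_integrable lborel supp w"
    "set_integrable lborel supp (\<lambda>t. poly A t * w t)" by simp_all
qed

definition weight_functional :: "complex poly \<Rightarrow> complex" where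
  "weight_functional p = (LINT t:supp|lborel. poly p (complex_of_real t) * complex_of_real (w t))"

lemma weight_functional_add: "weight_functional (p + q) = weight_functional p + weight_functional q"
  unfolding weight_functional_def
  by (simp add: distrib_right set_integral_add(2)[OF set_integrable_poly set_integrable_poly])

lemma weight_functional_smult: "weight_functional (smult c p) = c * weight_functional p"
  unfolding weight_functional_def by (simp add: mult.assoc)

lemma dist_supp:
  assumes "z \<notin> complex_of_real ` supp"
  obtains d where "d > 0" and "\<And>t. t \<in> supp \<Longrightarrow> d \<le> norm (complex_of_real t - z)"
proof -
  have "closed (complex_of_real ` supp)"
    using closed_supp by (intro closed_injective_linear_image) (auto simp: linear_of_real inj_on_def)
  from separate_point_closed[OF this assms] obtain d where
    "d > 0" "\<And>x. x \<in> complex_of_real ` supp \<Longrightarrow> d \<le> dist z x" by blast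
  moreover have "norm (complex_of_real t - z) = dist z (complex_of_real t)" for t
    by (simp add: dist_norm norm_minus_commute)
  ultimately show ?thesis by (intro that[of d]) auto
qed

lemma set_integrable_bounded_mult:
  fixes f g :: "real \<Rightarrow> complex"
  assumes f: "set_integrable lborel supp f" and [measurable]: "g \<in> borel_measurable borel"
    and le: "\<And>t. t \<in> supp \<Longrightarrow> norm (g t) \<le> K"
  shows "set_integrable lborel supp (\<lambda>t. g t * f t)"
proof -
  have [measurable]: "(\<lambda>t. indicat_real supp t *\<^sub>R f t) \<in> borel_measurable borel"
    using f by (auto simp: set_integrable_def dest: borel_measurable_integrable)
  have "integrable lborel (\<lambda>t. g t * (indicat_real supp t *\<^sub>R f t))"
  proof (rule Bochner_Integration.integrable_bound)
    show "integrable lborel (\<lambda>t. complex_of_real K * (indicat_real supp t *\<^sub>R f t))"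
      using f unfolding set_integrable_def by (rule integrable_mult_right)
    have "norm (g t) * norm (f t) \<le> \<bar>K\<bar> * norm (f t)" if "t \<in> supp" for t
      using le[OF that] by (intro mult_right_mono) auto
    then show "AE t in lborel. norm (g t * (indicat_real supp t *\<^sub>R f t))
        \<le> norm (complex_of_real K * (indicat_real supp t *\<^sub>R f t))"
      by (auto simp: norm_mult indicator_def)
    show "(\<lambda>t. g t * (indicat_real supp t *\<^sub>R f t)) \<in> borel_measurable lborel"
      by measurable
  qed
  then show ?thesis
    unfolding set_integrable_def by (simp add: mult.commute mult.left_commute)
qed

lemma set_integrable_kernel:
  assumes "z \<notin> complex_of_real ` supp"
  shows "set_integrable lborel supp
    (\<lambda>t. poly p (complex_of_real t) * complex_of_real (w t) / (complex_of_real t - z) ^ m)"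
proof -
  obtain d where d: "d > 0" "\<And>t. t \<in> supp \<Longrightarrow> d \<le> norm (complex_of_real t - z)"
    by (rule dist_supp[OF assms]) (rule that)
  have "set_integrable lborel supp (\<lambda>t. 1 / (complex_of_real t - z) ^ m *
      (poly p (complex_of_real t) * complex_of_real (w t)))"
  proof (rule set_integrable_bounded_mult[OF set_integrable_poly])
    show "norm (1 / (complex_of_real t - z) ^ m) \<le> 1 / d ^ m" if "t \<in> supp" for t
      using d(1) d(2)[OF that] by (auto simp: norm_divide norm_power intro!: divide_left_mono power_mono mult_pos_pos zero_less_power)
  qed auto
  then show ?thesis by (simp add: field_simps)
qed

text \<open>
  Near a zero \<open>\<beta>\<close> of \<open>A\<close> one has \<open>|A(y)| \<le> M |y - \<beta>|\<close>; if \<open>|A w| \<ge> \<delta>\<close> held up to \<open>\<beta>\<close>, the weight would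
  dominate \<open>(\<delta> / M) / |y - \<beta>|\<close> and not be integrable.
\<close>

lemma A_weight_small_near_root:
  assumes "poly A \<beta> = 0" and "t0 \<noteq> \<beta>" and "\<delta> > 0"
    and S: "\<And>y. y \<in> closed_segment t0 \<beta> \<Longrightarrow> y \<noteq> \<beta> \<Longrightarrow> y \<in> supp"
  shows "\<exists>y\<in>closed_segment t0 \<beta>. y \<noteq> \<beta> \<and> \<bar>poly A y * w y\<bar> < \<delta>"
proof (rule ccontr)
  assume contra: "\<not> ?thesis"
  have "bounded ((\<lambda>y. poly (synthetic_div A \<beta>) y) ` closed_segment t0 \<beta>)"
    by (intro compact_imp_bounded compact_continuous_image continuous_intros) auto
  then obtain M where M: "M > 0" "\<And>y. y \<in> closed_segment t0 \<beta> \<Longrightarrow> \<bar>poly (synthetic_div A \<beta>) y\<bar> \<le> M"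
    unfolding bounded_pos by auto
  have "\<delta> / M \<le> \<bar>w y\<bar> * \<bar>y - \<beta>\<bar>" if y: "y \<in> closed_segment t0 \<beta>" "y \<noteq> \<beta>" for y
  proof -
    have "\<delta> \<le> \<bar>poly A y * w y\<bar>" using contra y by force
    also have "\<dots> = \<bar>poly (synthetic_div A \<beta>) y\<bar> * (\<bar>w y\<bar> * \<bar>y - \<beta>\<bar>)"
      using poly_eq_synthetic_div[of A y \<beta>] \<open>poly A \<beta> = 0\<close> by (simp add: abs_mult)
    also have "\<dots> \<le> M * (\<bar>w y\<bar> * \<bar>y - \<beta>\<bar>)"
      using M(2)[OF y(1)] by (intro mult_right_mono) auto
    finally show ?thesis using M(1) by (simp add: field_simps)
  qed
  from not_integrable_near_pole[OF set_integrable_weight \<open>t0 \<noteq> \<beta>\<close> _ S this] M(1) \<open>\<delta> > 0\<close>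
  show False by simp
qed

lemma A_weight_small_near_infinity:
  assumes "s = 1 \<or> s = -1" and "\<delta> > 0" and "\<And>K. K \<ge> 0 \<Longrightarrow> t0 + s * K \<in> supp"
  shows "\<exists>K\<ge>0. \<bar>poly A (t0 + s * K) * w (t0 + s * K)\<bar> < \<delta>"
proof (rule ccontr)
  assume "\<not> ?thesis"
  then have "\<And>K. K \<ge> 0 \<Longrightarrow> \<delta> \<le> \<bar>poly A (t0 + s * K) * w (t0 + s * K)\<bar>" by force
  from not_integrable_near_infinity[OF set_integrable_A_weight \<open>\<delta> > 0\<close> assms(1,3) this]
  show False .
qed

lemma A_weight_small_near_upper_end:
  assumes ab: "(a, b) \<in> J" and t0: "t0 \<in> einterval a b" and "\<delta> > 0"
  shows "\<exists>y\<ge>t0. ereal y < b \<and> \<bar>poly A y * w y\<bar> < \<delta>"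
proof -
  have t0': "a < ereal t0" "ereal t0 < b" using t0 by (auto simp: einterval_iff)
  have S: "y \<in> supp" if "t0 \<le> y" "ereal y < b" for y
  proof -
    have "a < ereal y" by (rule less_le_trans[OF t0'(1)]) (simp add: that)
    then show ?thesis using that einterval_subset_supp[OF ab] by (auto simp: einterval_iff)
  qed
  consider "b = \<infinity>" | \<beta> where "b = ereal \<beta>" "poly A \<beta> = 0" using interval_props(3)[OF ab] by blast
  then show ?thesis
  proof cases
    case 1
    have "\<exists>K\<ge>0. \<bar>poly A (t0 + 1 * K) * w (t0 + 1 * K)\<bar> < \<delta>"
      by (rule A_weight_small_near_infinity[OF _ \<open>\<delta> > 0\<close>]) (auto intro!: S simp: 1)
    then obtain K where "K \<ge> 0" "\<bar>poly A (t0 + K) * w (t0 + K)\<bar> < \<delta>" by auto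
    then show ?thesis using 1 by (intro exI[of _ "t0 + K"]) simp
  next
    case 2
    then have "t0 < \<beta>" using t0'(2) by simp
    then have seg: "closed_segment t0 \<beta> = {t0..\<beta>}" by (simp add: closed_segment_eq_real_ivl)
    have "\<exists>y\<in>closed_segment t0 \<beta>. y \<noteq> \<beta> \<and> \<bar>poly A y * w y\<bar> < \<delta>"
      by (rule A_weight_small_near_root[OF 2(2) _ \<open>\<delta> > 0\<close>]) (use \<open>t0 < \<beta>\<close> in \<open>auto intro!: S simp: seg 2\<close>)
    then obtain y where "y \<in> {t0..\<beta>}" "y \<noteq> \<beta>" "\<bar>poly A y * w y\<bar> < \<delta>" unfolding seg by blast
    then show ?thesis using 2(1) by (intro exI[of _ y]) simp
  qed
qed

lemma A_weight_small_near_lower_end: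
  assumes ab: "(a, b) \<in> J" and t0: "t0 \<in> einterval a b" and "\<delta> > 0"
  shows "\<exists>y\<le>t0. a < ereal y \<and> \<bar>poly A y * w y\<bar> < \<delta>"
proof -
  have t0': "a < ereal t0" "ereal t0 < b" using t0 by (auto simp: einterval_iff)
  have S: "y \<in> supp" if "y \<le> t0" "a < ereal y" for y
  proof -
    have "ereal y < b" by (rule le_less_trans[OF _ t0'(2)]) (simp add: that)
    then show ?thesis using that einterval_subset_supp[OF ab] by (auto simp: einterval_iff)
  qed
  consider "a = -\<infinity>" | \<alpha> where "a = ereal \<alpha>" "poly A \<alpha> = 0" using interval_props(2)[OF ab] by blast
  then show ?thesis
  proof cases
    case 1
    have "\<exists>K\<ge>0. \<bar>poly A (t0 + -1 * K) * w (t0 + -1 * K)\<bar> < \<delta>"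
      by (rule A_weight_small_near_infinity[OF _ \<open>\<delta> > 0\<close>]) (auto intro!: S simp: 1)
    then obtain K where "K \<ge> 0" "\<bar>poly A (t0 - K) * w (t0 - K)\<bar> < \<delta>" by auto
    then show ?thesis using 1 by (intro exI[of _ "t0 - K"]) simp
  next
    case 2
    then have "\<alpha> < t0" using t0'(1) by simp
    then have seg: "closed_segment t0 \<alpha> = {\<alpha>..t0}" by (simp add: closed_segment_eq_real_ivl)
    have "\<exists>y\<in>closed_segment t0 \<alpha>. y \<noteq> \<alpha> \<and> \<bar>poly A y * w y\<bar> < \<delta>"
      by (rule A_weight_small_near_root[OF 2(2) _ \<open>\<delta> > 0\<close>]) (use \<open>\<alpha> < t0\<close> in \<open>auto intro!: S simp: seg 2\<close>)
    then obtain y where "y \<in> {\<alpha>..t0}" "y \<noteq> \<alpha>" "\<bar>poly A y * w y\<bar> < \<delta>" unfolding seg by blast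
    then show ?thesis using 2(1) by (intro exI[of _ y]) simp
  qed
qed

section \<open>The Stieltjes function and its first order equation\<close>

lemma integral_supp:
  fixes f :: "real \<Rightarrow> complex"
  assumes f: "set_integrable lborel supp f"
  shows "(LINT t:supp|lborel. f t) = (\<Sum>(a, b)\<in>J. LINT t:einterval a b|lborel. f t)"
proof -
  have "(LINT t:supp|lborel. f t) = (LINT t:interiors|lborel. f t)"
    unfolding set_lebesgue_integral_def
  proof (rule integral_discrete_difference[of "supp - interiors"])
    show "countable (supp - interiors)" using finite_supp_minus_interiors by (rule countable_finite)
    show "indicat_real supp t *\<^sub>R f t = indicat_real interiors t *\<^sub>R f t" if "t \<notin> supp - interiors" for t
      using that interiors_subset_supp by (auto simp: indicator_def)
  qed auto
  also have "\<dots> = (\<Sum>I\<in>J. LINT t:(case I of (a, b) \<Rightarrow> einterval a b)|lborel. f t)"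
    unfolding interiors_def
  proof (rule set_integral_finite_Union[OF finite_intervals])
    show "disjoint_family_on (\<lambda>(a, b). einterval a b) J"
      using weight unfolding semiclassical_weight_def admissible_intervals_def by (elim conjE)
    fix I assume I: "I \<in> J"
    obtain a b where ab: "I = (a, b)" by (cases I)
    show "(case I of (a, b) \<Rightarrow> einterval a b) \<in> sets lborel" by (simp add: ab)
    show "set_integrable lborel (case I of (a, b) \<Rightarrow> einterval a b) f"
      using I unfolding ab prod.case
      by (intro set_integrable_subset[OF f] einterval_subset_supp) auto
  qed
  finally show ?thesis by (simp add: case_prod_unfold)
qed

text \<open>
  The integrand is the derivative of \<open>A w / (t - z)\<close>, by the Pearson equation \<open>(A w)' = (A' + B) w\<close>,
  and \<open>A w\<close> is arbitrarily small near the ends of each interval, while \<open>1 / |t - z|\<close> is bounded.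
\<close>

lemma integral_Pearson_derivative_eq_0:
  assumes z: "z \<notin> complex_of_real ` supp"
  defines "g \<equiv> \<lambda>t. poly (cpoly (pderiv A + B)) (complex_of_real t) * complex_of_real (w t) / (complex_of_real t - z)
       - poly (cpoly A) (complex_of_real t) * complex_of_real (w t) / (complex_of_real t - z)\<^sup>2"
  shows "set_integrable lborel supp g" and "(LINT t:supp|lborel. g t) = 0"
proof -
  show int: "set_integrable lborel supp g"
    unfolding g_def using set_integrable_kernel[OF z, of "cpoly (pderiv A + B)" 1]
      set_integrable_kernel[OF z, of "cpoly A" 2]
    by (intro set_integral_diff(1)) simp_all
  define G where "G t = complex_of_real (poly A t * w t) * (1 / (complex_of_real t - z))" for t
  obtain d where d: "d > 0" "\<And>t. t \<in> supp \<Longrightarrow> d \<le> norm (complex_of_real t - z)"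
    by (rule dist_supp[OF z]) (rule that)
  have G_small: "norm (G t) < e" if "\<bar>poly A t * w t\<bar> < e * d" "t \<in> supp" for t e
  proof -
    have "norm (G t) = \<bar>poly A t * w t\<bar> / norm (complex_of_real t - z)"
      by (simp add: G_def norm_mult norm_divide abs_mult)
    also have "\<dots> \<le> \<bar>poly A t * w t\<bar> / d"
      using d(1) d(2)[OF that(2)] by (intro divide_left_mono mult_pos_pos) auto
    also have "\<dots> < e" using that(1) d(1) by (simp add: divide_less_eq)
    finally show ?thesis .
  qed
  have "(LINT t:einterval a b|lborel. g t) = 0" if ab: "(a, b) \<in> J" for a b
  proof (rule integral_derivative_eq_0[where G = G])
    show "a < b" using interval_props(1)[OF ab] .
    show "set_integrable lborel (einterval a b) g"
      by (rule set_integrable_subset[OF int]) (use einterval_subset_supp[OF ab] in auto)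
    have nz: "complex_of_real t - z \<noteq> 0" if "t \<in> einterval a b" for t
      using z einterval_subset_supp[OF ab] that by auto
    have contw: "continuous_on (einterval a b) w"
      using weight_has_derivative[OF ab]
      by (auto intro!: continuous_at_imp_continuous_on DERIV_isCont)
    show "continuous_on (einterval a b) g"
      unfolding g_def using nz by (intro continuous_intros contw) auto
    show "(G has_vector_derivative g t) (at t)" if t: "t \<in> einterval a b" for t
    proof -
      have "((\<lambda>t. poly A t * w t) has_real_derivative
          poly A t * (poly B t / poly A t * w t) + poly (pderiv A) t * w t) (at t)"
        by (rule DERIV_mult'[OF poly_DERIV weight_has_derivative[OF ab t]])
      also have "poly A t * (poly B t / poly A t * w t) + poly (pderiv A) t * w t =
          poly (pderiv A + B) t * w t"
        using interval_props(4)[OF ab] t by (simp add: algebra_simps)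
      finally have v: "((\<lambda>t. complex_of_real (poly A t * w t)) has_vector_derivative
          complex_of_real (poly (pderiv A + B) t * w t)) (at t)"
        using has_vector_derivative_complex_iff[of "\<lambda>t. complex_of_real (poly A t * w t)"
            "complex_of_real (poly (pderiv A + B) t * w t)" "at t"]
        by (simp add: has_real_derivative_iff_has_vector_derivative[symmetric] del: of_real_mult)
      have k: "((\<lambda>t. 1 / (complex_of_real t - z)) has_vector_derivative
          - 1 / (complex_of_real t - z)\<^sup>2) (at t)"
        by (rule has_vector_derivative_real_field)
           (use nz[OF t] in \<open>auto intro!: derivative_eq_intros simp: power2_eq_square\<close>)
      from has_vector_derivative_mult[OF v k] show ?thesis
        unfolding G_def
        by (rule back_subst[where P = "\<lambda>D. (_ has_vector_derivative D) (at t)"])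
           (simp add: g_def poly_cpoly_of_real)
    qed
    fix t0 e :: real assume t0: "t0 \<in> einterval a b" and "e > 0"
    then have ed: "e * d > 0" using d(1) by simp
    have S: "y \<in> supp" if "a < ereal y" "ereal y < b" for y
      using that einterval_subset_supp[OF ab] by (auto simp: einterval_iff)
    show "\<exists>y\<ge>t0. ereal y < b \<and> norm (G y) < e"
    proof -
      obtain y where y: "y \<ge> t0" "ereal y < b" "\<bar>poly A y * w y\<bar> < e * d"
        using A_weight_small_near_upper_end[OF ab t0 ed] by blast
      have "a < ereal y"
        by (rule less_le_trans[of _ "ereal t0"]) (use t0 y(1) in \<open>auto simp: einterval_iff\<close>)
      then show ?thesis using y G_small S by blast
    qed
    show "\<exists>y\<le>t0. a < ereal y \<and> norm (G y) < e"
    proof -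
      obtain y where y: "y \<le> t0" "a < ereal y" "\<bar>poly A y * w y\<bar> < e * d"
        using A_weight_small_near_lower_end[OF ab t0 ed] by blast
      have "ereal y < b"
        by (rule le_less_trans[of _ "ereal t0"]) (use t0 y(1) in \<open>auto simp: einterval_iff\<close>)
      then show ?thesis using y G_small S by blast
    qed
  qed
  then show "(LINT t:supp|lborel. g t) = 0"
    unfolding integral_supp[OF int] by (intro sum.neutral) auto
qed

text \<open>
  For \<open>m = 1\<close> this is the Stieltjes function of the weight and for \<open>m = 2\<close> its derivative.
\<close>

definition stieltjes :: "nat \<Rightarrow> complex \<Rightarrow> complex" where
  "stieltjes m z = (LINT t:supp|lborel. complex_of_real (w t) / (complex_of_real t - z) ^ m)"

lemma set_integrable_stieltjes:
  "z \<notin> complex_of_real ` supp \<Longrightarrow>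
    set_integrable lborel supp (\<lambda>t. complex_of_real (w t) / (complex_of_real t - z) ^ m)"
  using set_integrable_kernel[of z 1 m] by simp

text \<open>
  The difference quotient differs from the derivative by
  \<open>(y - z) \<integral> w(t) / ((t - z)\<^sup>2 (t - y)) dt\<close>. If \<open>z\<close> has distance at least \<open>d\<close> from the support and
  \<open>|y - z| < d/2\<close>, the kernel is bounded by \<open>2 / d\<^sup>3\<close>.
\<close>

lemma stieltjes_has_derivative:
  assumes z: "z \<notin> complex_of_real ` supp"
  shows "(stieltjes 1 has_field_derivative stieltjes 2 z) (at z)"
proof -
  obtain d where d: "d > 0" "\<And>t. t \<in> supp \<Longrightarrow> d \<le> norm (complex_of_real t - z)"
    by (rule dist_supp[OF z]) (rule that)
  define M where "M = (LINT t:supp|lborel. norm (complex_of_real (w t))) * (2 / d ^ 3)"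
  have bound: "norm ((stieltjes 1 y - stieltjes 1 z) / (y - z) - stieltjes 2 z) \<le> norm (y - z) * M"
    if y: "norm (y - z) < d / 2" "y \<noteq> z" for y
  proof -
    have dy: "d / 2 \<le> norm (complex_of_real t - y)" if "t \<in> supp" for t
      using norm_triangle_ineq[of "complex_of_real t - y" "y - z"] d(2)[OF that] y(1) by simp
    have y': "y \<notin> complex_of_real ` supp" using dy d(1) by force
    let ?r = "\<lambda>t. 1 / ((complex_of_real t - z)\<^sup>2 * (complex_of_real t - y))"
    have r: "norm (?r t) \<le> 2 / d ^ 3" if "t \<in> supp" for t
    proof -
      have "d\<^sup>2 * (d / 2) \<le> norm ((complex_of_real t - z)\<^sup>2 * (complex_of_real t - y))"
        unfolding norm_mult norm_power
        using d(1) d(2)[OF that] dy[OF that] by (intro mult_mono power_mono) auto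
      then have "norm (?r t) \<le> 1 / (d\<^sup>2 * (d / 2))"
        unfolding norm_divide norm_one using d(1)
        by (intro frac_le) auto
      then show ?thesis by (simp add: power2_eq_square power3_eq_cube)
    qed
    have w: "set_integrable lborel supp (\<lambda>t. complex_of_real (w t))"
      using set_integrable_monomial[of 0] by simp
    have ri: "set_integrable lborel supp (\<lambda>t. ?r t * complex_of_real (w t))"
      by (rule set_integrable_bounded_mult[OF w _ r]) auto
    have "(y - z)\<^sup>2 * (LINT t:supp|lborel. ?r t * complex_of_real (w t)) =
        (LINT t:supp|lborel. (y - z)\<^sup>2 * (?r t * complex_of_real (w t)))"
      by (rule set_integral_mult_right[symmetric])
    also have "\<dots> = (LINT t:supp|lborel. complex_of_real (w t) / (complex_of_real t - y) ^ 1
         - complex_of_real (w t) / (complex_of_real t - z) ^ 1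
         - (y - z) * (complex_of_real (w t) / (complex_of_real t - z) ^ 2))"
    proof (rule set_lebesgue_integral_cong)
      show "\<forall>t. t \<in> supp \<longrightarrow> (y - z)\<^sup>2 * (?r t * complex_of_real (w t)) =
         complex_of_real (w t) / (complex_of_real t - y) ^ 1
         - complex_of_real (w t) / (complex_of_real t - z) ^ 1
         - (y - z) * (complex_of_real (w t) / (complex_of_real t - z) ^ 2)"
      proof (intro allI impI)
        fix t assume "t \<in> supp"
        then have "complex_of_real t \<noteq> z" "complex_of_real t \<noteq> y" using z y' by auto
        then have nz: "complex_of_real t - z \<noteq> 0" "complex_of_real t - y \<noteq> 0" by auto
        define \<alpha> \<beta> where "\<alpha> = complex_of_real t - z" and "\<beta> = complex_of_real t - y"
        have yz: "y - z = \<alpha> - \<beta>" by (simp add: \<alpha>_def \<beta>_def)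
        show "(y - z)\<^sup>2 * (?r t * complex_of_real (w t)) =
         complex_of_real (w t) / (complex_of_real t - y) ^ 1
         - complex_of_real (w t) / (complex_of_real t - z) ^ 1
         - (y - z) * (complex_of_real (w t) / (complex_of_real t - z) ^ 2)"
          using nz unfolding yz \<alpha>_def[symmetric] \<beta>_def[symmetric]
          by (simp add: field_simps power2_eq_square)
      qed
    qed auto
    also have "\<dots> = stieltjes 1 y - stieltjes 1 z - (y - z) * stieltjes 2 z"
      unfolding stieltjes_def
      by (simp only: set_integral_diff(2)[OF set_integral_diff(1)[OF set_integrable_stieltjes[OF y']
              set_integrable_stieltjes[OF z]] set_integrable_mult_right[OF set_integrable_stieltjes[OF z]]]
          set_integral_diff(2)[OF set_integrable_stieltjes[OF y'] set_integrable_stieltjes[OF z]]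
          set_integral_mult_right)
    finally have "(stieltjes 1 y - stieltjes 1 z) / (y - z) - stieltjes 2 z =
        (y - z) * (LINT t:supp|lborel. ?r t * complex_of_real (w t))"
      using y(2) by (simp add: field_simps power2_eq_square)
    moreover have "norm (LINT t:supp|lborel. ?r t * complex_of_real (w t)) \<le> M"
    proof -
      have "norm (LINT t:supp|lborel. ?r t * complex_of_real (w t)) \<le>
          (LINT t:supp|lborel. norm (?r t * complex_of_real (w t)))"
        by (rule set_integral_norm_bound[OF ri])
      also have "\<dots> \<le> (LINT t:supp|lborel. norm (complex_of_real (w t)) * (2 / d ^ 3))"
      proof (rule set_integral_mono)
        show "set_integrable lborel supp (\<lambda>t. norm (complex_of_real (w t)) * (2 / d ^ 3))"
          using set_integrable_norm[OF w] by (rule set_integrable_mult_left)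
        show "norm (?r t * complex_of_real (w t)) \<le> norm (complex_of_real (w t)) * (2 / d ^ 3)"
          if "t \<in> supp" for t
          using mult_left_mono[OF r[OF that], of "norm (complex_of_real (w t))"]
          by (simp only: norm_mult norm_ge_zero mult.commute)
      qed (rule set_integrable_norm[OF ri])
      also have "\<dots> = M" unfolding M_def by (rule set_integral_mult_left)
      finally show ?thesis .
    qed
    ultimately show ?thesis by (simp add: norm_mult mult_left_mono)
  qed
  have "((\<lambda>y. (stieltjes 1 y - stieltjes 1 z) / (y - z) - stieltjes 2 z) \<longlongrightarrow> 0) (at z)"
  proof (rule Lim_null_comparison)
    have "((\<lambda>y. norm (y - z) * M) \<longlongrightarrow> norm (z - z) * M) (at z)" by (intro tendsto_intros)
    then show "((\<lambda>y. norm (y - z) * M) \<longlongrightarrow> 0) (at z)" by simp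
    show "\<forall>\<^sub>F y in at z. norm ((stieltjes 1 y - stieltjes 1 z) / (y - z) - stieltjes 2 z)
        \<le> norm (y - z) * M"
      unfolding eventually_at using d(1) bound by (intro exI[of _ "d / 2"]) (auto simp: dist_norm)
  qed
  then show ?thesis
    unfolding has_field_derivative_iff by (simp add: LIM_zero_iff)
qed

text \<open>
  By the expansions of \<open>A\<close> and \<open>B\<close> around \<open>t\<close>, the integrand \<open>(A(z)/(t - z)\<^sup>2 - B(z)/(t - z)) w(t)\<close> is
  \<open>(s\<^sub>A' + s\<^sub>B) w - (A w / (t - z))'\<close> with the divided differences \<open>s\<^sub>A\<close>, \<open>s\<^sub>B\<close> of \<open>A\<close>, \<open>B\<close>. The derivative
  integrates to \<open>0\<close> and the rest is a linear functional of divided differences, hence a polynomial.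
\<close>

lemma stieltjes_first_order_equation:
  "\<exists>k. \<forall>z. z \<notin> complex_of_real ` supp \<longrightarrow>
     poly (cpoly A) z * stieltjes 2 z - poly (cpoly B) z * stieltjes 1 z = poly k z"
proof -
  obtain k1 where k1: "\<And>z. poly k1 z = weight_functional (pderiv (synthetic_div (cpoly A) z))"
    using functional_synthetic_div_is_poly[of "\<lambda>p. weight_functional (pderiv p)" "cpoly A"]
    by (auto simp: pderiv_add pderiv_smult weight_functional_add weight_functional_smult)
  obtain k2 where k2: "\<And>z. poly k2 z = weight_functional (synthetic_div (cpoly B) z)"
    using functional_synthetic_div_is_poly[of weight_functional "cpoly B"]
    by (auto simp: weight_functional_add weight_functional_smult)
  have "poly (cpoly A) z * stieltjes 2 z - poly (cpoly B) z * stieltjes 1 z = poly (k1 + k2) z"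
    if z: "z \<notin> complex_of_real ` supp" for z
  proof -
    let ?a = "cpoly A" and ?b = "cpoly B"
    define g where "g t = poly (cpoly (pderiv A + B)) (complex_of_real t) * complex_of_real (w t) / (complex_of_real t - z)
       - poly (cpoly A) (complex_of_real t) * complex_of_real (w t) / (complex_of_real t - z)\<^sup>2" for t
    let ?q = "pderiv (synthetic_div ?a z) + synthetic_div ?b z"
    have cint: "set_integrable lborel supp
        (\<lambda>t. c * (complex_of_real (w t) / (complex_of_real t - z) ^ m))" for c m
      by (intro set_integrable_mult_right set_integrable_stieltjes z)
    note g = integral_Pearson_derivative_eq_0[OF z, folded g_def]
    have "poly ?a z * stieltjes 2 z - poly ?b z * stieltjes 1 z =
      (LINT t:supp|lborel. poly ?a z * (complex_of_real (w t) / (complex_of_real t - z) ^ 2)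
         - poly ?b z * (complex_of_real (w t) / (complex_of_real t - z) ^ 1))"
      unfolding stieltjes_def
      by (simp only: set_integral_diff(2)[OF cint cint] set_integral_mult_right)
    also have "\<dots> = (LINT t:supp|lborel. poly ?q (complex_of_real t) * complex_of_real (w t) - g t)"
    proof (rule set_lebesgue_integral_cong)
      show "\<forall>t. t \<in> supp \<longrightarrow> poly ?a z * (complex_of_real (w t) / (complex_of_real t - z) ^ 2)
         - poly ?b z * (complex_of_real (w t) / (complex_of_real t - z) ^ 1) =
         poly ?q (complex_of_real t) * complex_of_real (w t) - g t"
      proof (intro allI impI)
        fix t assume "t \<in> supp"
        define s where "s = complex_of_real t - z"
        have s: "s \<noteq> 0" using z \<open>t \<in> supp\<close> by (auto simp: s_def)
        define pa pb where "pa = poly (synthetic_div ?a z) (complex_of_real t)"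
          and "pb = poly (synthetic_div ?b z) (complex_of_real t)"
        define pa' where "pa' = poly (pderiv (synthetic_div ?a z)) (complex_of_real t)"
        have A: "poly ?a (complex_of_real t) = s * pa + poly ?a z"
          unfolding s_def pa_def by (rule poly_eq_synthetic_div)
        have B: "poly ?b (complex_of_real t) = s * pb + poly ?b z"
          unfolding s_def pb_def by (rule poly_eq_synthetic_div)
        have A': "poly (pderiv ?a) (complex_of_real t) = pa + s * pa'"
          unfolding s_def pa_def pa'_def by (rule poly_pderiv_eq_synthetic_div)
        have AB: "poly (cpoly (pderiv A + B)) (complex_of_real t) = pa + s * pa' + (s * pb + poly ?b z)"
          by (simp only: cpoly_add cpoly_pderiv poly_add A' B)
        show "poly ?a z * (complex_of_real (w t) / (complex_of_real t - z) ^ 2)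
         - poly ?b z * (complex_of_real (w t) / (complex_of_real t - z) ^ 1) =
         poly ?q (complex_of_real t) * complex_of_real (w t) - g t"
          unfolding g_def AB A poly_add pa'_def[symmetric] pb_def[symmetric] s_def[symmetric]
          using s by (simp add: field_simps power2_eq_square)
      qed
    qed auto
    also have "\<dots> = weight_functional ?q - 0"
      unfolding weight_functional_def g(2)[symmetric]
      by (rule set_integral_diff(2)[OF set_integrable_poly g(1)])
    finally show ?thesis by (simp add: k1 k2 weight_functional_add)
  qed
  then show ?thesis by blast
qed

text \<open>
  Split \<open>P(t) / (t - z)\<close> into the divided difference of \<open>P\<close> and \<open>P(z) / (t - z)\<close>.
\<close>

lemma cauchy_transform_poly:
  "\<exists>c. \<forall>z. z \<notin> complex_of_real ` supp \<longrightarrow>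
     cauchy_transform J w (poly P) z = poly c z + poly P z * stieltjes 1 z"
proof -
  obtain c where c: "\<And>z. poly c z = weight_functional (synthetic_div P z)"
    using functional_synthetic_div_is_poly[of weight_functional P]
    by (auto simp: weight_functional_add weight_functional_smult)
  have "cauchy_transform J w (poly P) z = poly c z + poly P z * stieltjes 1 z"
    if z: "z \<notin> complex_of_real ` supp" for z
  proof -
    have cint: "set_integrable lborel supp
        (\<lambda>t. c * (complex_of_real (w t) / (complex_of_real t - z) ^ m))" for c m
      by (intro set_integrable_mult_right set_integrable_stieltjes z)
    have "cauchy_transform J w (poly P) z =
      (LINT t:supp|lborel. poly (synthetic_div P z) (complex_of_real t) * complex_of_real (w t)
         + poly P z * (complex_of_real (w t) / (complex_of_real t - z) ^ 1))"
      unfolding cauchy_transform_def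
    proof (rule set_lebesgue_integral_cong)
      show "\<forall>t. t \<in> supp \<longrightarrow> poly P (complex_of_real t) * complex_of_real (w t) / (complex_of_real t - z) =
         poly (synthetic_div P z) (complex_of_real t) * complex_of_real (w t)
         + poly P z * (complex_of_real (w t) / (complex_of_real t - z) ^ 1)"
      proof (intro allI impI)
        fix t assume "t \<in> supp"
        then have "complex_of_real t - z \<noteq> 0" using z by auto
        then show "poly P (complex_of_real t) * complex_of_real (w t) / (complex_of_real t - z) =
         poly (synthetic_div P z) (complex_of_real t) * complex_of_real (w t)
         + poly P z * (complex_of_real (w t) / (complex_of_real t - z) ^ 1)"
          unfolding poly_eq_synthetic_div[of P "complex_of_real t" z] by (simp add: field_simps)
      qed
    qed auto
    also have "\<dots> = weight_functional (synthetic_div P z) + poly P z * stieltjes 1 z"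
      unfolding weight_functional_def stieltjes_def
      by (simp only: set_integral_add(2)[OF set_integrable_poly cint] set_integral_mult_right)
    finally show ?thesis by (simp add: c)
  qed
  then show ?thesis by blast
qed

end

section \<open>Partners and Wronskian as polynomials\<close>

text \<open>
  The only properties of a weight that matter for the differential equations: \<open>h\<close> is the Stieltjes
  function and \<open>h'\<close> its derivative.
\<close>

definition cauchy_decomposition ::
  "real poly \<Rightarrow> real poly \<Rightarrow> (ereal \<times> ereal) set \<Rightarrow> (real \<Rightarrow> real) \<Rightarrow> complex poly \<Rightarrow>
     complex poly \<Rightarrow> complex poly \<Rightarrow> (complex \<Rightarrow> complex) \<Rightarrow> (complex \<Rightarrow> complex) \<Rightarrow> bool" where
  "cauchy_decomposition A B J w P c k h h' \<longleftrightarrow>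
     open (- complex_of_real ` support_set J) \<and>
     (\<forall>z. z \<notin> complex_of_real ` support_set J \<longrightarrow>
        cauchy_transform J w (poly P) z = poly c z + poly P z * h z \<and>
        (h has_field_derivative h' z) (at z) \<and>
        poly (cpoly A) z * h' z = poly (cpoly B) z * h z + poly k z)"

lemma (in semiclassical) cauchy_decomposition_exists:
  "\<exists>c k h h'. cauchy_decomposition A B J w P c k h h'"
proof -
  obtain c where "\<forall>z. z \<notin> complex_of_real ` supp \<longrightarrow>
     cauchy_transform J w (poly P) z = poly c z + poly P z * stieltjes 1 z"
    using cauchy_transform_poly by blast
  moreover obtain k where "\<forall>z. z \<notin> complex_of_real ` supp \<longrightarrow>
     poly (cpoly A) z * stieltjes 2 z - poly (cpoly B) z * stieltjes 1 z = poly k z"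
    using stieltjes_first_order_equation by blast
  moreover have "open (- complex_of_real ` supp)"
    using closed_supp by (intro open_Compl closed_injective_linear_image) (auto simp: linear_of_real inj_on_def)
  ultimately have "cauchy_decomposition A B J w P c k (stieltjes 1) (stieltjes 2)"
    unfolding cauchy_decomposition_def
    by (auto intro!: stieltjes_has_derivative simp: algebra_simps simp del: One_nat_def)
  then show ?thesis by blast
qed

lemma electrostatic_partner_eq_poly:
  assumes dec: "cauchy_decomposition A B J w P c k h h'"
    and z: "z \<notin> complex_of_real ` support_set J"
  shows "electrostatic_partner A B J w (poly P) z = poly (partner_poly (cpoly A) (cpoly B) P c k) z"
proof -
  let ?C = "cauchy_transform J w (poly P)"
  have C: "?C z = poly c z + poly P z * h z" and h: "(h has_field_derivative h' z) (at z)"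
    and lin: "poly (cpoly A) z * h' z = poly (cpoly B) z * h z + poly k z"
    using dec z unfolding cauchy_decomposition_def by auto
  have "((\<lambda>z. poly c z + poly P z * h z) has_field_derivative
      poly (pderiv c) z + (poly P z * h' z + poly (pderiv P) z * h z)) (at z)"
    by (intro derivative_intros poly_DERIV h DERIV_mult')
  then have "(?C has_field_derivative
      poly (pderiv c) z + (poly P z * h' z + poly (pderiv P) z * h z)) (at z)"
    by (rule has_field_derivative_transform_within_open[where S = "- complex_of_real ` support_set J"])
       (use dec z in \<open>auto simp: cauchy_decomposition_def\<close>)
  then have C': "deriv ?C z = poly (pderiv c) z + (poly P z * h' z + poly (pderiv P) z * h z)"
    by (rule DERIV_imp_deriv)
  have P': "deriv (poly P) z = poly (pderiv P) z"
    by (rule DERIV_imp_deriv[OF poly_DERIV])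
  show ?thesis
    unfolding electrostatic_partner_def Let_def det_2 C C' P' partner_poly_def partner_cofactor_def
    using lin by simp algebra
qed

text \<open>
  On \<open>U\<close> the equation for \<open>h\<close> removes \<open>h'\<close> from \<open>A W q' = A (c + P h)' - B (c + P h)\<close> and leaves
  \<open>F + A P' h\<close>. So one further derivative again meets only \<open>h\<close> and \<open>h'\<close>, and \<open>h'\<close> is removed once more.
\<close>

lemma second_kind_jet:
  assumes dec: "cauchy_decomposition A B J w P c k h h'"
    and branch: "exp_branch A B U W" and disj: "U \<inter> complex_of_real ` support_set J = {}"
    and z: "z \<in> U"
  defines "q \<equiv> second_kind J w W P" and "a \<equiv> poly (cpoly A) z"
    and "F \<equiv> partner_cofactor (cpoly A) (cpoly B) P c k"
  shows "a\<^sup>2 * W z * q z = poly ((cpoly A)\<^sup>2 * c) z + a\<^sup>2 * h z * poly P z"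
    and "a\<^sup>2 * W z * deriv q z = poly (cpoly A * F) z + a\<^sup>2 * h z * poly (pderiv P) z"
    and "a\<^sup>2 * W z * deriv (deriv q) z =
       poly (second_jet (cpoly A) (cpoly B) P c k) z + a\<^sup>2 * h z * poly (pderiv (pderiv P)) z"
    and "W z \<noteq> 0" and "a \<noteq> 0"
proof -
  let ?a = "poly (cpoly A)" and ?b = "poly (cpoly B)" and ?a' = "poly (pderiv (cpoly A))"
  have "open U" using branch by (simp add: exp_branch_def)
  obtain G where G: "\<And>y. y \<in> U \<Longrightarrow> ?a y \<noteq> 0"
    "\<And>y. y \<in> U \<Longrightarrow> (G has_field_derivative ?b y / ?a y) (at y)"
    "\<And>y. y \<in> U \<Longrightarrow> W y = exp (G y)"
    using branch unfolding exp_branch_def by blast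
  have W0: "W y \<noteq> 0" if "y \<in> U" for y using G(3)[OF that] by simp
  have W': "(W has_field_derivative ?b y / ?a y * W y) (at y)" if y: "y \<in> U" for y
  proof -
    have "((\<lambda>y. exp (G y)) has_field_derivative ?b y / ?a y * W y) (at y)"
      using G(3)[OF y] by (auto intro!: derivative_eq_intros G(2) y)
    then show ?thesis
      by (rule has_field_derivative_transform_within_open[OF _ \<open>open U\<close> y]) (simp add: G(3))
  qed
  have dec': "q y = (poly c y + poly P y * h y) / W y" "(h has_field_derivative h' y) (at y)"
    "?a y * h' y = ?b y * h y + poly k y" if "y \<in> U" for y
  proof -
    have "y \<notin> complex_of_real ` support_set J" using disj that by blast
    then show "q y = (poly c y + poly P y * h y) / W y" "(h has_field_derivative h' y) (at y)"
      "?a y * h' y = ?b y * h y + poly k y"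
      using dec unfolding cauchy_decomposition_def q_def second_kind_def by auto
  qed
  define num where "num y = poly F y + ?a y * poly (pderiv P) y * h y" for y
  have q': "(q has_field_derivative num y / (?a y * W y)) (at y)" if y: "y \<in> U" for y
  proof -
    have "((\<lambda>y. (poly c y + poly P y * h y) / W y) has_field_derivative
       ((poly (pderiv c) y + (poly P y * h' y + poly (pderiv P) y * h y)) * W y
          - (poly c y + poly P y * h y) * (?b y / ?a y * W y)) / (W y * W y)) (at y)"
      by (intro DERIV_divide DERIV_add DERIV_mult' poly_DERIV dec'(2) y W' W0)
    also have "((poly (pderiv c) y + (poly P y * h' y + poly (pderiv P) y * h y)) * W y
          - (poly c y + poly P y * h y) * (?b y / ?a y * W y)) / (W y * W y) =
       (?a y * poly (pderiv c) y + poly P y * (?a y * h' y) + ?a y * poly (pderiv P) y * h y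
          - (poly c y + poly P y * h y) * ?b y) / (?a y * W y)"
      using G(1)[OF y] W0[OF y] by (simp add: field_simps)
    also have "\<dots> = num y / (?a y * W y)"
      unfolding dec'(3)[OF y] num_def F_def partner_cofactor_def by (simp add: algebra_simps)
    finally show ?thesis
      by (rule has_field_derivative_transform_within_open[OF _ \<open>open U\<close> y]) (simp add: dec'(1))
  qed
  have dq: "deriv q y = num y / (?a y * W y)" if "y \<in> U" for y
    by (rule DERIV_imp_deriv[OF q'[OF that]])
  define num' where "num' = poly (pderiv F) z + (?a z * poly (pderiv P) z * h' z
      + (?a z * poly (pderiv (pderiv P)) z + ?a' z * poly (pderiv P) z) * h z)"
  have "((\<lambda>y. num y / (?a y * W y)) has_field_derivative
      (num' * (?a z * W z) - num z * (?a z * (?b z / ?a z * W z) + ?a' z * W z))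
        / ((?a z * W z) * (?a z * W z))) (at z)"
    unfolding num_def num'_def
    by (intro DERIV_divide DERIV_add DERIV_mult' poly_DERIV dec'(2) z W') (use W0 G(1) z in auto)
  then have "(deriv q has_field_derivative
      (num' * (?a z * W z) - num z * (?a z * (?b z / ?a z * W z) + ?a' z * W z))
        / ((?a z * W z) * (?a z * W z))) (at z)"
    by (rule has_field_derivative_transform_within_open[OF _ \<open>open U\<close> z]) (simp add: dq)
  then have ddq: "deriv (deriv q) z =
      (num' * (?a z * W z) - num z * (?a z * (?b z / ?a z * W z) + ?a' z * W z))
        / ((?a z * W z) * (?a z * W z))"
    by (rule DERIV_imp_deriv)
  show Wz: "W z \<noteq> 0" and az: "a \<noteq> 0" using W0 G(1) z by (auto simp: a_def)
  show "a\<^sup>2 * W z * q z = poly ((cpoly A)\<^sup>2 * c) z + a\<^sup>2 * h z * poly P z"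
  proof -
    have "W z * q z = poly c z + poly P z * h z" using Wz dec'(1)[OF z] by simp
    then have "a\<^sup>2 * W z * q z = a\<^sup>2 * (poly c z + poly P z * h z)" by simp
    then show ?thesis by (simp add: a_def algebra_simps)
  qed
  show "a\<^sup>2 * W z * deriv q z = poly (cpoly A * F) z + a\<^sup>2 * h z * poly (pderiv P) z"
    using Wz az dq[OF z] by (simp add: num_def a_def[symmetric] field_simps power2_eq_square)
  have "a\<^sup>2 * W z * deriv (deriv q) z = num' * a - num z * (?b z + ?a' z)"
    unfolding ddq a_def[symmetric] using Wz az by (simp add: field_simps power2_eq_square)
  also have "num' * a = a * poly (pderiv F) z + a * poly (pderiv P) z * (?a z * h' z)
      + a * (a * poly (pderiv (pderiv P)) z + ?a' z * poly (pderiv P) z) * h z"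
    unfolding num'_def a_def[symmetric] by (simp add: algebra_simps)
  finally show "a\<^sup>2 * W z * deriv (deriv q) z =
       poly (second_jet (cpoly A) (cpoly B) P c k) z + a\<^sup>2 * h z * poly (pderiv (pderiv P)) z"
    unfolding dec'(3)[OF z] num_def second_jet_def Let_def F_def[symmetric]
    by (simp add: a_def algebra_simps power2_eq_square)
qed

lemma wronskian3_eq_det3:
  "wronskian3 f g h z = det3 (f z) (deriv f z) (deriv (deriv f) z)
     (g z) (deriv g z) (deriv (deriv g) z) (h z) (deriv h z) (deriv (deriv h) z)"
  unfolding wronskian3_def det_3 det3_def by (simp add: algebra_simps)

lemma poly_det3:
  "poly (det3 p0 p1 p2 x0 x1 x2 y0 y1 y2) z =
   det3 (poly p0 z) (poly p1 z) (poly p2 z) (poly x0 z) (poly x1 z) (poly x2 z) (poly y0 z) (poly y1 z) (poly y2 z)"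
  by (simp add: det3_def)

text \<open>
  The factor \<open>A\<^sub>1 A\<^sub>2 v\<^sub>1 v\<^sub>2 = (A\<^sub>1\<^sup>2 W\<^sub>1) (A\<^sub>2\<^sup>2 W\<^sub>2)\<close> is distributed over the last two columns. These
  become polynomial up to multiples of the first column \<open>(P, P', P'')\<close>.
\<close>

lemma wronskian3_eq_poly:
  assumes dec1: "cauchy_decomposition A1 B1 J1 w1 P c1 k1 h1 h1'"
    and dec2: "cauchy_decomposition A2 B2 J2 w2 P c2 k2 h2 h2'"
    and pair: "branch_pair A1 B1 J1 A2 B2 J2 U W1 W2" and z: "z \<in> U"
  defines "a1 \<equiv> poly (cpoly A1) z" and "a2 \<equiv> poly (cpoly A2) z"
  shows "poly (wronskian_poly (cpoly A1) (cpoly B1) (cpoly A2) (cpoly B2) P c1 k1 c2 k2) z =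
    a1 * a2 * (a1 * W1 z) * (a2 * W2 z) *
      wronskian3 (poly P) (second_kind J1 w1 W1 P) (second_kind J2 w2 W2 P) z"
proof -
  have branches: "exp_branch A1 B1 U W1" "exp_branch A2 B2 U W2"
    and disj: "U \<inter> complex_of_real ` support_set J1 = {}" "U \<inter> complex_of_real ` support_set J2 = {}"
    using pair unfolding branch_pair_def by auto
  note jet1 = second_kind_jet[OF dec1 branches(1) disj(1) z, folded a1_def]
  note jet2 = second_kind_jet[OF dec2 branches(2) disj(2) z, folded a2_def]
  have P': "deriv (poly P) = poly (pderiv P)" for P :: "complex poly"
    by (rule ext) (rule DERIV_imp_deriv[OF poly_DERIV])
  have "a1 * a2 * (a1 * W1 z) * (a2 * W2 z) = (a1\<^sup>2 * W1 z) * (a2\<^sup>2 * W2 z)"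
    by (simp add: power2_eq_square)
  then show ?thesis
    unfolding wronskian3_eq_det3 P' wronskian_poly_def poly_det3
    by (simp only: det3_scale[symmetric] jet1(1-3) jet2(1-3) det3_add_multiple)
qed

section \<open>The differential equations\<close>

theorem theorem5p7:
  fixes A1 B1 A2 B2 :: "real poly"
    and J1 J2 :: "(ereal \<times> ereal) set"
    and w1 w2 :: "real \<Rightarrow> real"
    and n1 n2 :: nat
    and P :: "complex poly"
  assumes weight1: "semiclassical_weight A1 B1 J1 w1"
    and weight2: "semiclassical_weight A2 B2 J2 w2"
    and P_monic: "lead_coeff P = 1"
    and P_degree: "degree P = n1 + n2"
    and orth1: "\<forall>j<n1. moment J1 w1 P j = 0" "moment J1 w1 P n1 \<noteq> 0"
    and orth2: "\<forall>j<n2. moment J2 w2 P j = 0" "moment J2 w2 P n2 \<noteq> 0"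
    and wronskian_nonzero:
      "\<exists>U W1 W2. branch_pair A1 B1 J1 A2 B2 J2 U W1 W2 \<and>
         (\<exists>z\<in>U. wronskian3 (poly P) (second_kind J1 w1 W1 P) (second_kind J2 w2 W2 P) z \<noteq> 0)"
  shows
    "\<exists>S1 S2 R :: complex poly.
       (\<forall>z. z \<notin> complex_of_real ` support_set J1 \<longrightarrow>
          poly S1 z = electrostatic_partner A1 B1 J1 w1 (poly P) z) \<and>
       (\<forall>z. z \<notin> complex_of_real ` support_set J2 \<longrightarrow>
          poly S2 z = electrostatic_partner A2 B2 J2 w2 (poly P) z) \<and>
       (\<forall>U W1 W2. branch_pair A1 B1 J1 A2 B2 J2 U W1 W2 \<longrightarrow>
          (\<forall>z\<in>U. let a1 = poly (cpoly A1) z; a2 = poly (cpoly A2) z;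
                     v1 = a1 * W1 z; v2 = a2 * W2 z
                 in poly R z = (a1 * a2 * v1 * v2) *
                      wronskian3 (poly P) (second_kind J1 w1 W1 P) (second_kind J2 w2 W2 P) z)) \<and>
       (\<exists>D1 D2.
          solves_ode2
            (cpoly (A1 * A2) * P * R)
            (cpoly (2 * A1 * pderiv A2 + A1 * B2 - A2 * B1) * P * R
               - cpoly (A1 * A2) * (P * pderiv R + pderiv P * R))
            D1 S1 \<and>
          solves_ode2
            (cpoly (A1 * A2) * P * R)
            (cpoly (2 * pderiv A1 * A2 - A1 * B2 + A2 * B1) * P * R
               - cpoly (A1 * A2) * (P * pderiv R + pderiv P * R))
            D2 S2 \<and>
          (A1 = A2 \<and> B1 = B2 \<longrightarrow>
             (\<exists>Rstar Dstar.
                R = cpoly A1 ^ 2 * Rstar \<and>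
                D1 = cpoly A1 ^ 4 * Dstar \<and> D2 = cpoly A1 ^ 4 * Dstar \<and>
                solves_ode2 (P * Rstar) (- (pderiv P * Rstar + P * pderiv Rstar)) Dstar S1 \<and>
                solves_ode2 (P * Rstar) (- (pderiv P * Rstar + P * pderiv Rstar)) Dstar S2)))"
proof -
  obtain c1 k1 h1 h1' where dec1: "cauchy_decomposition A1 B1 J1 w1 P c1 k1 h1 h1'"
    using semiclassical.cauchy_decomposition_exists[OF semiclassical.intro[OF weight1]] by blast
  obtain c2 k2 h2 h2' where dec2: "cauchy_decomposition A2 B2 J2 w2 P c2 k2 h2 h2'"
    using semiclassical.cauchy_decomposition_exists[OF semiclassical.intro[OF weight2]] by blast
  define a1 b1 a2 b2 where "a1 = cpoly A1" and "b1 = cpoly B1" and "a2 = cpoly A2" and "b2 = cpoly B2"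
  note ab = a1_def[symmetric] b1_def[symmetric] a2_def[symmetric] b2_def[symmetric]
  define S1 S2 where "S1 = partner_poly a1 b1 P c1 k1" and "S2 = partner_poly a2 b2 P c2 k2"
  define R where "R = wronskian_poly a1 b1 a2 b2 P c1 k1 c2 k2"
  define g where "g = a2 * (pderiv a1 + b1) - a1 * (pderiv a2 + b2)"
  define H1 H2 where "H1 = 2 * a1 * pderiv a2 + a1 * b2 - a2 * b1"
    and "H2 = 2 * pderiv a1 * a2 - a1 * b2 + a2 * b1"
  define D1 where "D1 = a1 * a2 * pderiv (a1 * a2 * pderiv S2 + g * S2) * pderiv S1
        - (a1 * a2 * pderiv S2 + g * S2) * (a1 * a2 * pderiv (pderiv S1) + H1 * pderiv S1)"
  define D2 where "D2 = a1 * a2 * pderiv (a1 * a2 * pderiv S1 + (- g) * S1) * pderiv S2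
        - (a1 * a2 * pderiv S1 + (- g) * S1) * (a1 * a2 * pderiv (pderiv S2) + H2 * pderiv S2)"
  have PR: "P * R = a1 * a2 * (S1 * pderiv S2 - pderiv S1 * S2) + g * (S1 * S2)"
    unfolding R_def S1_def S2_def g_def by (rule wronskian_poly_factor)
  have ode1: "solves_ode2 (a1 * a2 * P * R)
      (H1 * P * R - a1 * a2 * (P * pderiv R + pderiv P * R)) D1 S1"
    unfolding D1_def by (rule partner_ode[OF PR]) (simp add: H1_def g_def pderiv_mult algebra_simps)
  \<comment> \<open>Exchanging the two weights changes the signs of \<open>R\<close> and of \<open>g\<close>.\<close>
  have PR': "P * (- R) = a1 * a2 * (S2 * pderiv S1 - pderiv S2 * S1) + (- g) * (S2 * S1)"
    using PR by (simp add: algebra_simps)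
  have "solves_ode2 (a1 * a2 * P * (- R))
      (H2 * P * (- R) - a1 * a2 * (P * pderiv (- R) + pderiv P * (- R))) D2 S2"
    unfolding D2_def by (rule partner_ode[OF PR']) (simp add: H2_def g_def pderiv_mult algebra_simps)
  then have ode2: "solves_ode2 (a1 * a2 * P * R)
      (H2 * P * R - a1 * a2 * (P * pderiv R + pderiv P * R)) (- D2) S2"
    unfolding solves_ode2_def pderiv_minus by algebra
  have same: "\<exists>Rstar Dstar.
                R = a1 ^ 2 * Rstar \<and> D1 = a1 ^ 4 * Dstar \<and> - D2 = a1 ^ 4 * Dstar \<and>
                solves_ode2 (P * Rstar) (- (pderiv P * Rstar + P * pderiv Rstar)) Dstar S1 \<and>
                solves_ode2 (P * Rstar) (- (pderiv P * Rstar + P * pderiv Rstar)) Dstar S2"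
    if eq: "A1 = A2" "B1 = B2"
  proof -
    have eq': "a2 = a1" "b2 = b1" using eq by (simp_all add: a1_def a2_def b1_def b2_def)
    have g0: "g = 0" by (simp add: g_def eq')
    have "P \<noteq> 0" using P_monic by auto
    then obtain Rs where Rs: "R = a1\<^sup>2 * Rs" "P * Rs = S1 * pderiv S2 - pderiv S1 * S2"
      unfolding R_def S1_def S2_def eq' by (rule equal_weights_factor)
    define Ds where "Ds = pderiv S1 * pderiv (pderiv S2) - pderiv (pderiv S1) * pderiv S2"
    have "pderiv P * Rs + P * pderiv Rs = pderiv (P * Rs)"
      by (simp add: pderiv_mult algebra_simps)
    also have "\<dots> = S1 * pderiv (pderiv S2) - pderiv (pderiv S1) * S2"
      unfolding Rs(2) by (simp add: pderiv_diff pderiv_mult algebra_simps)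
    finally have PRs': "pderiv P * Rs + P * pderiv Rs = S1 * pderiv (pderiv S2) - pderiv (pderiv S1) * S2" .
    have "solves_ode2 (P * Rs) (- (pderiv P * Rs + P * pderiv Rs)) Ds S1"
      "solves_ode2 (P * Rs) (- (pderiv P * Rs + P * pderiv Rs)) Ds S2"
      unfolding solves_ode2_def Rs(2) PRs' Ds_def by (simp_all add: algebra_simps)
    moreover have "D1 = a1 ^ 4 * Ds" "- D2 = a1 ^ 4 * Ds"
      unfolding D1_def D2_def g0 H1_def H2_def eq' Ds_def
      by (simp_all add: pderiv_mult algebra_simps power4_eq_xxxx)
    ultimately show ?thesis using Rs(1) by blast
  qed
  have H: "cpoly (2 * A1 * pderiv A2 + A1 * B2 - A2 * B1) = H1"
    "cpoly (2 * pderiv A1 * A2 - A1 * B2 + A2 * B1) = H2" "cpoly (A1 * A2) = a1 * a2"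
    by (simp_all only: H1_def H2_def a1_def a2_def b1_def b2_def cpoly_add cpoly_diff cpoly_mult
        cpoly_two cpoly_pderiv)
  show ?thesis
  proof (rule exI[of _ S1], rule exI[of _ S2], rule exI[of _ R], intro conjI allI impI ballI)
    fix z assume "z \<notin> complex_of_real ` support_set J1"
    from electrostatic_partner_eq_poly[OF dec1 this]
    show "poly S1 z = electrostatic_partner A1 B1 J1 w1 (poly P) z"
      by (simp add: S1_def ab)
  next
    fix z assume "z \<notin> complex_of_real ` support_set J2"
    from electrostatic_partner_eq_poly[OF dec2 this]
    show "poly S2 z = electrostatic_partner A2 B2 J2 w2 (poly P) z"
      by (simp add: S2_def ab)
  next
    fix U W1 W2 z assume "branch_pair A1 B1 J1 A2 B2 J2 U W1 W2" "z \<in> U"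
    from wronskian3_eq_poly[OF dec1 dec2 this]
    show "let a1 = poly (cpoly A1) z; a2 = poly (cpoly A2) z; v1 = a1 * W1 z; v2 = a2 * W2 z
       in poly R z = (a1 * a2 * v1 * v2) *
            wronskian3 (poly P) (second_kind J1 w1 W1 P) (second_kind J2 w2 W2 P) z"
      unfolding Let_def R_def ab .
  qed (rule exI[of _ D1], rule exI[of _ "- D2"], unfold H ab, use ode1 ode2 same in blast)
qed

end
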